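(* Let $(K,\nu)$ be a non-trivial valuation field with metric completion $(\hat K,\hat\nu)$ and let $X$ be a finite-dimensional vector space over $K$. Then: 1. $\hat F:\tau_K(X)\to\sigma_{\hat K}(\hat X)$ and $\hat G:\sigma_{\hat K}(\hat X)\to\tau_K(X)$ invert inclusions: $T\subset T'$ implies $\hat F(T')\subset\hat F(T)$ for $T,T'\in\tau_K(X)$, and $S\subset S'$ implies $\hat G(S')\subset\hat G(S)$ for $S,S'\in\sigma_{\hat K}(\hat X)$. 2. $\hat F\circ\hat G=\mathrm{id}_{\sigma_{\hat K}(\hat X)}$. 3. $T\subset\hat G\circ\hat F(T)$ for all $T\in\tau_K(X)$. 4. If $\hat K$ is a locally compact space with respect to the metric $d_{\hat\nu}$, then $\hat G\circ\hat F=\mathrm{id}_{\tau_K(X)}$. Thus the lattice $(\tau_K(X),\subset)$ is lattice isomorphic to $(\sigma_{\hat K}(\hat X),\supset)$ by $\hat F$.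
   Context: A topology on a set is a family of subsets satisfying the open set axioms (homeomorphic topologies are not identified). A valuation on a (commutative) field $K$ is a function $\nu:K\to\mathbb{R}$ with $\nu(\alpha)\ge 0$; $\nu(\alpha)=0\Leftrightarrow\alpha=0$; $\nu(\alpha\beta)=\nu(\alpha)\nu(\beta)$; $\nu(\alpha+\beta)\le\nu(\alpha)+\nu(\beta)$ for all $\alpha,\beta\in K$. The valuation field $(K,\nu)$ carries the topology of the metric $d_\nu(\alpha,\beta)=\nu(\alpha-\beta)$; it is non-trivial if this topology is not discrete. $\hat K$ denotes the metric completion of $(K,d_\nu)$, a valuation field with the extended operations and the extended valuation $\hat\nu$. For a vector space $Z$ over a Hausdorff topological field $k$, a (possibly non-Hausdorff) topology on $Z$ is compatible if addition $Z\times Z\to Z$ and scalar multiplication $k\times Z\to Z$ are continuous (product topologies on the domains). $\tau_k(Z)$ is the set of all compatible topologies on $Z$, $\sigma_k(Z)$ is the set of all $k$-linear subspaces of $Z$, and $T_k^{\max}(Z)$ is the largest element of $\tau_k(Z)$ with respect to inclusion (it exists). $(\tau_k(Z),\subset)$ and $(\sigma_k(Z),\supset)$ are lattices; a lattice isomorphism is a bijection preserving joins and meets. $\mathrm{cl}_T[A]$ is the closure of $A$ with respect to $T$. Put $\hat X=\hat K\otimes_K X$ and let $I:X\to\hat X$, $I(x)=1\otimes x$ (injective). For a $\hat K$-subspace $S$ of $\hat X$ let $\pi_S:\hat X\to\hat X/S$ be the quotient map and let $$G(S)=\{\pi_S^{-1}(V)\mid V\subset \hat X/S,\ \pi_S^{-1}(V)\in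 T_{\hat K}^{\max}(\hat X)\}\in\tau_{\hat K}(\hat X).$$ Define, for $T\in\tau_K(X)$ and $S\in\sigma_{\hat K}(\hat X)$, $$\hat F(T)=\bigcap_{0\in U\in T}\mathrm{cl}_{T_{\hat K}^{\max}(\hat X)}[I(U)],\qquad \hat G(S)=\{I^{-1}(V)\mid V\in G(S)\}.$$ These are a $\hat K$-subspace of $\hat X$ and a compatible topology on $X$, respectively. *)

theory Defs
  imports "HOL-Analysis.Analysis" "HOL-Algebra.Complete_Lattice" "HOL-Library.Poly_Mapping"
begin

definition valuation :: "('k::field \<Rightarrow> real) \<Rightarrow> bool"
  where "valuation \<nu> \<longleftrightarrow>
    (\<forall>a. 0 \<le> \<nu> a) \<and> (\<forall>a. \<nu> a = 0 \<longleftrightarrow> a = 0) \<and>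
    (\<forall>a b. \<nu> (a * b) = \<nu> a * \<nu> b) \<and> (\<forall>a b. \<nu> (a + b) \<le> \<nu> a + \<nu> b)"

definition val_dist :: "('k::field \<Rightarrow> real) \<Rightarrow> 'k \<Rightarrow> 'k \<Rightarrow> real"
  where "val_dist \<nu> a b = \<nu> (a - b)"

definition val_topology :: "('k::field \<Rightarrow> real) \<Rightarrow> 'k topology"
  where "val_topology \<nu> = Metric_space.mtopology UNIV (val_dist \<nu>)"

definition nontrivial_valuation :: "('k::field \<Rightarrow> real) \<Rightarrow> bool"
  where "nontrivial_valuation \<nu> \<longleftrightarrow> valuation \<nu> \<and> val_topology \<nu> \<noteq> discrete_topology UNIV"

text \<open>The completion is determined up to unique isomorphism of valuation fields, so it is
  given as any complete valuation field \<open>(\<nu>', 'l)\<close> with an isometric field embedding \<open>\<iota>\<close> of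
  \<open>'k\<close> onto a dense subfield.\<close>

definition valuation_completion ::
    "('k::field \<Rightarrow> real) \<Rightarrow> ('l::field \<Rightarrow> real) \<Rightarrow> ('k \<Rightarrow> 'l) \<Rightarrow> bool"
  where "valuation_completion \<nu> \<nu>' \<iota> \<longleftrightarrow>
    valuation \<nu> \<and> valuation \<nu>' \<and>
    \<iota> 1 = 1 \<and> (\<forall>a b. \<iota> (a + b) = \<iota> a + \<iota> b) \<and> (\<forall>a b. \<iota> (a * b) = \<iota> a * \<iota> b) \<and>
    (\<forall>a. \<nu>' (\<iota> a) = \<nu> a) \<and>
    val_topology \<nu>' closure_of (range \<iota>) = UNIV \<and>
    Metric_space.mcomplete UNIV (val_dist \<nu>')"

text \<open>The subgroup of the free abelian group on \<open>'l \<times> 'x\<close> generated by the defining relations of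
  the tensor product over \<open>'k\<close>; \<open>'l\<close> is a \<open>'k\<close>-module through \<open>\<iota>\<close>.\<close>

inductive_set tensor_relations ::
    "('k::field \<Rightarrow> 'l::field) \<Rightarrow> ('k \<Rightarrow> 'x::ab_group_add \<Rightarrow> 'x) \<Rightarrow> (('l \<times> 'x) \<Rightarrow>\<^sub>0 int) set"
  for \<iota> sX where
    "frag_of (a + b, x) - frag_of (a, x) - frag_of (b, x) \<in> tensor_relations \<iota> sX"
  | "frag_of (a, x + y) - frag_of (a, x) - frag_of (a, y) \<in> tensor_relations \<iota> sX"
  | "frag_of (a * \<iota> c, x) - frag_of (a, sX c x) \<in> tensor_relations \<iota> sX"
  | "0 \<in> tensor_relations \<iota> sX"
  | "f \<in> tensor_relations \<iota> sX \<Longrightarrow> g \<in> tensor_relations \<iota> sX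
      \<Longrightarrow> f - g \<in> tensor_relations \<iota> sX"

text \<open>The homomorphism from the free abelian group on \<open>'l \<times> 'x\<close> sending \<open>(a, x)\<close> to \<open>t a x\<close>.\<close>

definition tensor_eval ::
    "('l::field \<Rightarrow> 'y::ab_group_add \<Rightarrow> 'y) \<Rightarrow> ('l \<Rightarrow> 'x \<Rightarrow> 'y) \<Rightarrow> (('l \<times> 'x) \<Rightarrow>\<^sub>0 int) \<Rightarrow> 'y"
  where "tensor_eval sY t f =
    (\<Sum>(a, x) \<in> Poly_Mapping.keys f. sY (of_int (Poly_Mapping.lookup f (a, x))) (t a x))"

text \<open>The vector space \<open>('y, sY)\<close> over \<open>'l\<close>, with pure tensors \<open>t a x\<close>, is the tensor
  product of \<open>'l\<close> and \<open>'x\<close> over \<open>'k\<close>: the map \<open>(a, x) \<mapsto> t a x\<close> identifies \<open>'y\<close> with the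
  quotient of the free abelian group by the tensor relations (so \<open>t\<close> is balanced and biadditive),
  and \<open>'l\<close> acts on the left factor.\<close>

definition is_tensor_product ::
    "('k::field \<Rightarrow> 'l::field) \<Rightarrow> ('k \<Rightarrow> 'x::ab_group_add \<Rightarrow> 'x) \<Rightarrow>
     ('l \<Rightarrow> 'y::ab_group_add \<Rightarrow> 'y) \<Rightarrow> ('l \<Rightarrow> 'x \<Rightarrow> 'y) \<Rightarrow> bool"
  where "is_tensor_product \<iota> sX sY t \<longleftrightarrow>
    vector_space sY \<and>
    (\<forall>c a x. sY c (t a x) = t (c * a) x) \<and>
    surj (tensor_eval sY t) \<and>
    {f. tensor_eval sY t f = 0} = tensor_relations \<iota> sX"

definition compatible_topologies ::
    "'k topology \<Rightarrow> ('k \<Rightarrow> 'z::ab_group_add \<Rightarrow> 'z) \<Rightarrow> 'z topology set"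
  where "compatible_topologies kt sZ = {T. topspace T = UNIV \<and>
    continuous_map (prod_topology T T) T (\<lambda>(x, y). x + y) \<and>
    continuous_map (prod_topology kt T) T (\<lambda>(a, x). sZ a x)}"

definition topology_subset :: "'a topology \<Rightarrow> 'a topology \<Rightarrow> bool"
  where "topology_subset T T' \<longleftrightarrow> {U. openin T U} \<subseteq> {U. openin T' U}"

definition compatible_order ::
    "'k topology \<Rightarrow> ('k \<Rightarrow> 'z::ab_group_add \<Rightarrow> 'z) \<Rightarrow> 'z topology gorder"
  where "compatible_order kt sZ =
    \<lparr>carrier = compatible_topologies kt sZ, eq = (=), le = topology_subset\<rparr>"

definition subspaces :: "('k::field \<Rightarrow> 'z::ab_group_add \<Rightarrow> 'z) \<Rightarrow> 'z set set"
  where "subspaces sZ = {S. module.subspace sZ S}"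

text \<open>Subspaces are ordered by reverse inclusion.\<close>

definition subspace_order :: "('k::field \<Rightarrow> 'z::ab_group_add \<Rightarrow> 'z) \<Rightarrow> 'z set gorder"
  where "subspace_order sZ =
    \<lparr>carrier = subspaces sZ, eq = (=), le = (\<lambda>S S'. S' \<subseteq> S)\<rparr>"

definition max_compatible_topology ::
    "'k topology \<Rightarrow> ('k \<Rightarrow> 'z::ab_group_add \<Rightarrow> 'z) \<Rightarrow> 'z topology"
  where "max_compatible_topology kt sZ = \<top>\<^bsub>compatible_order kt sZ\<^esub>"

text \<open>The quotient map modulo \<open>S\<close>; the quotient space is \<open>range (coset_map S)\<close>.\<close>

definition coset_map :: "'z::ab_group_add set \<Rightarrow> 'z \<Rightarrow> 'z set"
  where "coset_map S x = (\<lambda>s. x + s) ` S"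

definition quotient_pullback_topology ::
    "'k topology \<Rightarrow> ('k \<Rightarrow> 'z::ab_group_add \<Rightarrow> 'z) \<Rightarrow> 'z set \<Rightarrow> 'z topology"
  where "quotient_pullback_topology kt sZ S = topology (\<lambda>U. \<exists>V \<subseteq> range (coset_map S).
    U = coset_map S -` V \<and> openin (max_compatible_topology kt sZ) (coset_map S -` V))"

lemma openin_quotient_pullback_topology:
  "openin (quotient_pullback_topology kt sZ S) U \<longleftrightarrow> (\<exists>V \<subseteq> range (coset_map S).
    U = coset_map S -` V \<and> openin (max_compatible_topology kt sZ) (coset_map S -` V))"
proof -
  let ?P = "\<lambda>U. \<exists>V \<subseteq> range (coset_map S).
    U = coset_map S -` V \<and> openin (max_compatible_topology kt sZ) (coset_map S -` V)"
  have "istopology ?P"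
    unfolding istopology_def
  proof (intro conjI allI impI)
    fix U U' assume "?P U" "?P U'"
    then obtain V V' where "V \<subseteq> range (coset_map S)" "U = coset_map S -` V"
        "openin (max_compatible_topology kt sZ) (coset_map S -` V)"
        "U' = coset_map S -` V'"
        "openin (max_compatible_topology kt sZ) (coset_map S -` V')"
      by blast
    then show "?P (U \<inter> U')"
      by (intro exI[of _ "V \<inter> V'"]) (auto simp: vimage_Int)
  next
    fix \<U> assume "\<forall>U\<in>\<U>. ?P U"
    then obtain V where V: "\<And>U. U \<in> \<U> \<Longrightarrow> V U \<subseteq> range (coset_map S) \<and>
        U = coset_map S -` V U \<and> openin (max_compatible_topology kt sZ) (coset_map S -` V U)"
      by metis
    have "\<Union>\<U> = coset_map S -` (\<Union>U\<in>\<U>. V U)"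
      using V by blast
    moreover have "openin (max_compatible_topology kt sZ) (\<Union>\<U>)"
      using V by (intro openin_Union) metis
    moreover have "(\<Union>U\<in>\<U>. V U) \<subseteq> range (coset_map S)"
      using V by blast
    ultimately show "?P (\<Union>\<U>)"
      by (intro exI[of _ "\<Union>U\<in>\<U>. V U"]) simp
  qed
  then show ?thesis
    unfolding quotient_pullback_topology_def by (simp add: topology_inverse')
qed

text \<open>In the following, \<open>T\<close> is a topology on \<open>'x\<close>, \<open>S\<close> a subspace of the tensor product \<open>'y\<close>, and
  \<open>t 1\<close> is the embedding of \<open>'x\<close> into \<open>'y\<close>.\<close>

definition F_hat ::
    "('l::field \<Rightarrow> real) \<Rightarrow> ('l \<Rightarrow> 'y::ab_group_add \<Rightarrow> 'y) \<Rightarrow> ('l \<Rightarrow> 'x::ab_group_add \<Rightarrow> 'y) \<Rightarrow>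
     'x topology \<Rightarrow> 'y set"
  where "F_hat \<nu>' sY t T =
    (\<Inter>U \<in> {U. openin T U \<and> 0 \<in> U}.
      max_compatible_topology (val_topology \<nu>') sY closure_of (t 1 ` U))"

definition G_hat ::
    "('l::field \<Rightarrow> real) \<Rightarrow> ('l \<Rightarrow> 'y::ab_group_add \<Rightarrow> 'y) \<Rightarrow> ('l \<Rightarrow> 'x::ab_group_add \<Rightarrow> 'y) \<Rightarrow>
     'y set \<Rightarrow> 'x topology"
  where "G_hat \<nu>' sY t S =
    pullback_topology UNIV (t 1) (quotient_pullback_topology (val_topology \<nu>') sY S)"

definition lattice_isomorphism ::
    "('a, 'c) gorder_scheme \<Rightarrow> ('b, 'd) gorder_scheme \<Rightarrow> ('a \<Rightarrow> 'b) \<Rightarrow> bool"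
  where "lattice_isomorphism L M f \<longleftrightarrow>
    bij_betw f (carrier L) (carrier M) \<and> join_pres L M f \<and> meet_pres L M f"

end

theory Submission
  imports Defs
begin

text \<open>In coordinates with respect to a basis of \<open>X\<close>, which is also a basis of its completed tensor
  product \<open>Y\<close>, the largest compatible topology on \<open>Y\<close> is given by the sum norm \<open>N\<close>. The topology
  \<open>G S\<close> is then given by the seminorm \<open>x \<mapsto> q S (1 \<otimes> x)\<close>, where \<open>q S y\<close> is the \<open>N\<close>-distance of \<open>y\<close>
  from \<open>S\<close>. Since subspaces of \<open>Y\<close> are closed and \<open>X\<close> is dense in \<open>Y\<close>, \<open>S\<close> is recovered from \<open>G S\<close>
  as the set of points adherent to every neighbourhood of 0. Conversely, every neighbourhood
  of 0 in \<open>T\<close> contains all points of \<open>X\<close> close to \<open>F T\<close>, because \<open>T\<close> is coarser than the topology of \<open>N\<close>.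
  If balls are compact, a compactness argument shows that points of \<open>X\<close> that are small for \<open>T\<close> are
  close to \<open>F T\<close>.\<close>

section \<open>Valuations and seminorms\<close>

lemma valuation_nonneg: "valuation \<nu> \<Longrightarrow> 0 \<le> \<nu> a"
  and valuation_eq_0_iff: "valuation \<nu> \<Longrightarrow> \<nu> a = 0 \<longleftrightarrow> a = 0"
  and valuation_mult: "valuation \<nu> \<Longrightarrow> \<nu> (a * b) = \<nu> a * \<nu> b"
  and valuation_add: "valuation \<nu> \<Longrightarrow> \<nu> (a + b) \<le> \<nu> a + \<nu> b"
  by (auto simp: valuation_def)

lemma valuation_0: "valuation \<nu> \<Longrightarrow> \<nu> 0 = 0"
  by (simp add: valuation_eq_0_iff)

lemma valuation_1:
  assumes "valuation \<nu>"
  shows "\<nu> 1 = 1"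
  using valuation_mult[OF assms, of 1 1] valuation_eq_0_iff[OF assms, of 1] by simp

lemma valuation_uminus:
  assumes "valuation \<nu>"
  shows "\<nu> (- a) = \<nu> a"
proof -
  have "\<nu> (-1) * \<nu> (-1) = 1"
    using valuation_mult[OF assms, of "-1" "-1"] valuation_1[OF assms] by simp
  then have "(\<nu> (-1) - 1) * (\<nu> (-1) + 1) = 0"
    by (simp add: algebra_simps)
  then have "\<nu> (-1) = 1"
    using valuation_nonneg[OF assms, of "-1"] by auto
  then show ?thesis
    using valuation_mult[OF assms, of "-1" a] by simp
qed

lemma valuation_power:
  assumes "valuation \<nu>"
  shows "\<nu> (a ^ n) = \<nu> a ^ n"
  by (induction n) (simp_all add: valuation_1 valuation_mult assms)

lemma valuation_inverse:
  assumes "valuation \<nu>"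
  shows "\<nu> (inverse a) = inverse (\<nu> a)"
proof (cases "a = 0")
  case False
  then have "\<nu> a * \<nu> (inverse a) = 1"
    using valuation_mult[OF assms, of a "inverse a"] valuation_1[OF assms] by simp
  then show ?thesis
    by (metis inverse_unique)
qed (simp add: valuation_0 assms)

text \<open>The axioms of a topology hold for an arbitrary function \<open>p\<close>, so one
  definition covers the valuations, the norm on Y and the distances from subspaces.\<close>

definition seminorm_topology :: "('z::ab_group_add \<Rightarrow> real) \<Rightarrow> 'z topology"
  where "seminorm_topology p = topology (\<lambda>U. \<forall>x\<in>U. \<exists>e>0. \<forall>z. p (z - x) < e \<longrightarrow> z \<in> U)"

lemma openin_seminorm_topology:
  "openin (seminorm_topology p) U \<longleftrightarrow> (\<forall>x\<in>U. \<exists>e>0. \<forall>z. p (z - x) < e \<longrightarrow> z \<in> U)"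
proof -
  have "istopology (\<lambda>U. \<forall>x\<in>U. \<exists>e>0. \<forall>z. p (z - x) < e \<longrightarrow> z \<in> U)"
    unfolding istopology_def
  proof (intro conjI allI impI ballI)
    fix S T x
    assume "\<forall>x\<in>S. \<exists>e>0. \<forall>z. p (z - x) < e \<longrightarrow> z \<in> S"
      "\<forall>x\<in>T. \<exists>e>0. \<forall>z. p (z - x) < e \<longrightarrow> z \<in> T" "x \<in> S \<inter> T"
    then obtain e f where "e > 0" "f > 0"
      "\<forall>z. p (z - x) < e \<longrightarrow> z \<in> S" "\<forall>z. p (z - x) < f \<longrightarrow> z \<in> T"
      by blast
    then show "\<exists>e>0. \<forall>z. p (z - x) < e \<longrightarrow> z \<in> S \<inter> T"
      by (intro exI[of _ "min e f"]) auto
  next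
    fix \<U> x
    assume "\<forall>U\<in>\<U>. \<forall>x\<in>U. \<exists>e>0. \<forall>z. p (z - x) < e \<longrightarrow> z \<in> U" "x \<in> \<Union>\<U>"
    then obtain U e where "U \<in> \<U>" "e > 0" "\<forall>z. p (z - x) < e \<longrightarrow> z \<in> U"
      by blast
    then show "\<exists>e>0. \<forall>z. p (z - x) < e \<longrightarrow> z \<in> \<Union>\<U>"
      by blast
  qed
  then show ?thesis
    unfolding seminorm_topology_def by (simp add: topology_inverse')
qed

lemma topspace_seminorm_topology [simp]: "topspace (seminorm_topology p) = UNIV"
proof -
  have "openin (seminorm_topology p) UNIV"
    unfolding openin_seminorm_topology using zero_less_one by blast
  then show ?thesis
    using openin_subset by blast
qed

lemma val_topology_eq_seminorm_topology:
  assumes "valuation \<nu>"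
  shows "val_topology \<nu> = seminorm_topology \<nu>"
proof -
  have sym: "\<nu> (a - b) = \<nu> (b - a)" for a b
    using valuation_uminus[OF assms, of "a - b"] by simp
  interpret Metric_space UNIV "val_dist \<nu>"
  proof
    fix a b c
    show "val_dist \<nu> a c \<le> val_dist \<nu> a b + val_dist \<nu> b c"
      using valuation_add[OF assms, of "a - b" "b - c"] by (simp add: val_dist_def)
  qed (auto simp: val_dist_def valuation_nonneg valuation_eq_0_iff assms sym)
  show ?thesis
    unfolding val_topology_def topology_eq openin_mtopology openin_seminorm_topology
    by (auto simp: mball_def val_dist_def sym subset_iff)
qed

text \<open>If every nonzero scalar had value at least 1, open unit balls would be singletons and
  the topology discrete.\<close>

lemma nontrivial_valuation_small:
  assumes "nontrivial_valuation \<nu>"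
  obtains c where "0 < \<nu> c" "\<nu> c < 1"
proof -
  have val: "valuation \<nu>" and nd: "val_topology \<nu> \<noteq> discrete_topology UNIV"
    using assms by (auto simp: nontrivial_valuation_def)
  have "\<exists>c. c \<noteq> 0 \<and> \<nu> c < 1"
  proof (rule ccontr)
    assume "\<not> ?thesis"
    then have "z = x" if "\<nu> (z - x) < 1" for z x
      using that by (metis eq_iff_diff_eq_0)
    then have "openin (val_topology \<nu>) U" for U
      unfolding val_topology_eq_seminorm_topology[OF val] openin_seminorm_topology
      by (metis zero_less_one)
    then show False
      using nd by (simp add: topology_eq)
  qed
  then show ?thesis
    using that valuation_nonneg[OF val] valuation_eq_0_iff[OF val] by (metis less_eq_real_def)
qed

section \<open>Seminorms over a valued field\<close>

locale valued_vector_space = vector_space scale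
  for scale :: "'k::field \<Rightarrow> 'z::ab_group_add \<Rightarrow> 'z" (infixr \<open>\<cdot>\<close> 75) +
  fixes \<nu> :: "'k \<Rightarrow> real"
  assumes valuation: "valuation \<nu>"
begin

text \<open>Scaling by 0 gives \<open>p 0 = 0\<close>; nonnegativity then follows from 0 = p (x - x)
  \<le> 2 p x.\<close>

definition is_seminorm :: "('z \<Rightarrow> real) \<Rightarrow> bool"
  where "is_seminorm p \<longleftrightarrow>
    (\<forall>x y. p (x + y) \<le> p x + p y) \<and> (\<forall>a x. p (a \<cdot> x) = \<nu> a * p x)"

context
  fixes p
  assumes p: "is_seminorm p"
begin

lemma seminorm_add: "p (x + y) \<le> p x + p y"
  and seminorm_scale: "p (a \<cdot> x) = \<nu> a * p x"
  using p by (auto simp: is_seminorm_def)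

lemma seminorm_0: "p 0 = 0"
  using seminorm_scale[of 0 0] by (simp add: valuation_0 valuation)

lemma seminorm_uminus: "p (- x) = p x"
  using seminorm_scale[of "-1" x] by (simp add: valuation valuation_uminus valuation_1)

lemma seminorm_diff: "p (x - y) \<le> p x + p y"
  using seminorm_add[of x "- y"] by (simp add: seminorm_uminus)

lemma seminorm_triangle: "p (x - z) \<le> p (x - y) + p (y - z)"
  using seminorm_add[of "x - y" "y - z"] by simp

lemma seminorm_nonneg: "0 \<le> p x"
  using seminorm_diff[of x x] by (simp add: seminorm_0)

lemma openin_seminorm_ball: "openin (seminorm_topology p) {z. p (z - x) < e}"
  unfolding openin_seminorm_topology
proof
  fix y assume y: "y \<in> {z. p (z - x) < e}"
  have "p (z - x) < e" if "p (z - y) < e - p (y - x)" for z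
    using seminorm_triangle[of z x y] that by simp
  with y show "\<exists>d>0. \<forall>z. p (z - y) < d \<longrightarrow> z \<in> {z. p (z - x) < e}"
    by (intro exI[of _ "e - p (y - x)"]) simp
qed

lemma in_closure_of_seminorm_topology:
  "y \<in> seminorm_topology p closure_of A \<longleftrightarrow> (\<forall>e>0. \<exists>a\<in>A. p (a - y) < e)"
proof
  assume L: "y \<in> seminorm_topology p closure_of A"
  show "\<forall>e>0. \<exists>a\<in>A. p (a - y) < e"
  proof (intro allI impI)
    fix e :: real assume "e > 0"
    then have "y \<in> {z. p (z - y) < e}"
      by (simp add: seminorm_0)
    then have "\<exists>a. a \<in> A \<and> a \<in> {z. p (z - y) < e}"
      using L openin_seminorm_ball[of y e] unfolding in_closure_of by metis
    then show "\<exists>a\<in>A. p (a - y) < e"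
      by blast
  qed
next
  assume R: "\<forall>e>0. \<exists>a\<in>A. p (a - y) < e"
  show "y \<in> seminorm_topology p closure_of A"
    unfolding in_closure_of
  proof (intro conjI allI impI)
    fix U assume "y \<in> U \<and> openin (seminorm_topology p) U"
    then obtain e where e: "e > 0" "\<forall>z. p (z - y) < e \<longrightarrow> z \<in> U"
      unfolding openin_seminorm_topology by blast
    obtain a where "a \<in> A" "p (a - y) < e"
      using R e(1) by blast
    with e(2) show "\<exists>a. a \<in> A \<and> a \<in> U"
      by blast
  qed simp
qed

lemma seminorm_topology_compatible:
  "seminorm_topology p \<in> compatible_topologies (val_topology \<nu>) scale"
proof -
  let ?T = "seminorm_topology p"
  have "continuous_map (prod_topology ?T ?T) ?T (\<lambda>(x, y). x + y)"
    unfolding continuous_map openin_prod_topology_alt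
  proof (intro conjI allI impI)
    fix U x y
    assume U: "openin ?T U"
      and "(x, y) \<in> {z \<in> topspace (prod_topology ?T ?T). (case z of (x, y) \<Rightarrow> x + y) \<in> U}"
    then have "x + y \<in> U"
      by simp
    then obtain e where e: "e > 0" "\<forall>z. p (z - (x + y)) < e \<longrightarrow> z \<in> U"
      using U unfolding openin_seminorm_topology by blast
    let ?V = "\<lambda>x. {z. p (z - x) < e / 2}"
    have "x' + y' \<in> U" if "p (x' - x) < e / 2" "p (y' - y) < e / 2" for x' y'
    proof -
      have "p (x' + y' - (x + y)) < e"
        using seminorm_add[of "x' - x" "y' - y"] that by (simp add: algebra_simps)
      then show ?thesis
        using e by blast
    qed
    then have "?V x \<times> ?V y \<subseteq> {z \<in> topspace (prod_topology ?T ?T). (case z of (x, y) \<Rightarrow> x + y) \<in> U}"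
      by auto
    moreover have "x \<in> ?V x" "y \<in> ?V y"
      using e by (auto simp: seminorm_0)
    ultimately show "\<exists>V W. openin ?T V \<and> openin ?T W \<and> x \<in> V \<and> y \<in> W \<and>
        V \<times> W \<subseteq> {z \<in> topspace (prod_topology ?T ?T). (case z of (x, y) \<Rightarrow> x + y) \<in> U}"
      using openin_seminorm_ball by blast
  qed auto
  moreover have "continuous_map (prod_topology (val_topology \<nu>) ?T) ?T (\<lambda>(a, x). a \<cdot> x)"
    unfolding continuous_map openin_prod_topology_alt val_topology_eq_seminorm_topology[OF valuation]
  proof (intro conjI allI impI)
    let ?K = "seminorm_topology \<nu>"
    fix U a x
    assume U: "openin ?T U"
      and "(a, x) \<in> {z \<in> topspace (prod_topology ?K ?T). (case z of (a, x) \<Rightarrow> a \<cdot> x) \<in> U}"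
    then have "a \<cdot> x \<in> U"
      by simp
    then obtain e where e: "e > 0" "\<forall>z. p (z - a \<cdot> x) < e \<longrightarrow> z \<in> U"
      using U unfolding openin_seminorm_topology by blast
    \<comment> \<open>In \<open>b \<cdot> y - a \<cdot> x = b \<cdot> (y - x) + (b - a) \<cdot>
      x\<close> the radius \<open>r\<close> controls the first summand and \<open>d\<close> the
      second; \<open>d \<le> 1\<close> also gives \<open>\<nu> b \<le> \<nu> a + 1\<close>. The
      added ones keep the denominators positive.\<close>
    define d where "d = min 1 (e / (2 * (p x + 1)))"
    define r where "r = e / (2 * (\<nu> a + 1))"
    have px: "0 \<le> p x" and va: "0 \<le> \<nu> a"
      by (auto simp: seminorm_nonneg valuation valuation_nonneg)
    have d: "d > 0" and r: "r > 0"
      using e px va by (auto simp: d_def r_def)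
    have dle: "d * p x \<le> e / 2"
    proof -
      have "d * p x \<le> e / (2 * (p x + 1)) * (p x + 1)"
        using px e by (intro mult_mono) (auto simp: d_def)
      also have "\<dots> = e / 2"
        using px by (simp add: field_simps)
      finally show ?thesis .
    qed
    have "b \<cdot> y \<in> U" if "\<nu> (b - a) < d" "p (y - x) < r" for b y
    proof -
      have "b \<cdot> y - a \<cdot> x = b \<cdot> (y - x) + (b - a) \<cdot> x"
        by (simp add: scale_right_diff_distrib scale_left_diff_distrib)
      then have "p (b \<cdot> y - a \<cdot> x) \<le> \<nu> b * p (y - x) + \<nu> (b - a) * p x"
        by (metis seminorm_add seminorm_scale)
      moreover have "\<nu> b \<le> \<nu> a + 1"
        using valuation_add[OF valuation, of "b - a" a] that(1) by (simp add: d_def)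
      then have "\<nu> b * p (y - x) \<le> (\<nu> a + 1) * p (y - x)"
        by (intro mult_right_mono seminorm_nonneg)
      moreover have "(\<nu> a + 1) * p (y - x) < e / 2"
      proof -
        have "(\<nu> a + 1) * p (y - x) < (\<nu> a + 1) * r"
          using that(2) va by simp
        also have "\<dots> = e / 2"
          using va by (simp add: r_def field_simps)
        finally show ?thesis .
      qed
      moreover have "\<nu> (b - a) * p x \<le> d * p x"
        using that(1) px by (intro mult_right_mono) auto
      ultimately have "p (b \<cdot> y - a \<cdot> x) < e"
        using dle by linarith
      then show ?thesis
        using e by blast
    qed
    then have "{b. \<nu> (b - a) < d} \<times> {y. p (y - x) < r}
        \<subseteq> {z \<in> topspace (prod_topology ?K ?T). (case z of (a, x) \<Rightarrow> a \<cdot> x) \<in> U}"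
      by auto
    moreover have "a \<in> {b. \<nu> (b - a) < d}" "x \<in> {y. p (y - x) < r}"
      using d r by (auto simp: seminorm_0 valuation_0 valuation)
    moreover have "openin ?K {b. \<nu> (b - a) < d}"
      unfolding openin_seminorm_topology
    proof
      fix y assume y: "y \<in> {b. \<nu> (b - a) < d}"
      have "\<nu> (z - a) < d" if "\<nu> (z - y) < d - \<nu> (y - a)" for z
        using valuation_add[OF valuation, of "z - y" "y - a"] that by simp
      with y show "\<exists>e>0. \<forall>z. \<nu> (z - y) < e \<longrightarrow> z \<in> {b. \<nu> (b - a) < d}"
        by (intro exI[of _ "d - \<nu> (y - a)"]) simp
    qed
    ultimately show "\<exists>V W. openin ?K V \<and> openin ?T W \<and> a \<in> V \<and> x \<in> W \<and>
        V \<times> W \<subseteq> {z \<in> topspace (prod_topology ?K ?T). (case z of (a, x) \<Rightarrow> a \<cdot> x) \<in> U}"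
      using openin_seminorm_ball by blast
  qed auto
  ultimately show ?thesis
    by (simp add: compatible_topologies_def)
qed

end

text \<open>This is the quotient seminorm modulo \<open>S\<close>, pulled back along the quotient
  map.\<close>

definition subspace_dist :: "('z \<Rightarrow> real) \<Rightarrow> 'z set \<Rightarrow> 'z \<Rightarrow> real"
  where "subspace_dist p S y = (INF s\<in>S. p (y - s))"

context
  fixes p S
  assumes p: "is_seminorm p" and S: "subspace S"
begin

text \<open>The infimum need not be attained, so estimates go through points of \<open>S\<close>
  that are almost nearest.\<close>

lemma subspace_dist_less_iff: "subspace_dist p S y < e \<longleftrightarrow> (\<exists>s\<in>S. p (y - s) < e)"
  unfolding subspace_dist_def
proof (rule cINF_less_iff)
  show "S \<noteq> {}"
    using S subspace_0 by blast
  show "bdd_below ((\<lambda>s. p (y - s)) ` S)"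
    by (intro bdd_belowI2[of _ 0] seminorm_nonneg[OF p])
qed

lemma subspace_dist_le: "s \<in> S \<Longrightarrow> subspace_dist p S y \<le> p (y - s)"
  using subspace_dist_less_iff by (meson linorder_not_le order.irrefl)

lemma subspace_dist_nonneg: "0 \<le> subspace_dist p S y"
  using subspace_dist_less_iff seminorm_nonneg[OF p] by (meson linorder_not_le)

text \<open>An almost nearest point is scaled along with \<open>y\<close>. Dividing the slack by
  \<open>\<nu> a + 1\<close> covers \<open>a = 0\<close> as well. The reverse inequality for nonzero
  \<open>a\<close> comes from applying this one to \<open>inverse a\<close>.\<close>

lemma subspace_dist_scale_le: "subspace_dist p S (a \<cdot> y) \<le> \<nu> a * subspace_dist p S y"
proof (rule field_le_epsilon)
  fix e :: real assume "e > 0"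
  have va: "0 \<le> \<nu> a"
    by (simp add: valuation valuation_nonneg)
  have "subspace_dist p S y < subspace_dist p S y + e / (\<nu> a + 1)"
    using \<open>e > 0\<close> va by simp
  then obtain s where s: "s \<in> S" "p (y - s) < subspace_dist p S y + e / (\<nu> a + 1)"
    unfolding subspace_dist_less_iff[of y] by blast
  have "subspace_dist p S (a \<cdot> y) \<le> p (a \<cdot> y - a \<cdot> s)"
    using s S by (intro subspace_dist_le) (auto simp: subspace_scale)
  also have "\<dots> = \<nu> a * p (y - s)"
    by (simp add: seminorm_scale[OF p] flip: scale_right_diff_distrib)
  also have "\<dots> \<le> \<nu> a * (subspace_dist p S y + e / (\<nu> a + 1))"
    using s va by (intro mult_left_mono) auto
  also have "\<dots> \<le> \<nu> a * subspace_dist p S y + e"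
    using va \<open>e > 0\<close> by (simp add: field_simps)
  finally show "subspace_dist p S (a \<cdot> y) \<le> \<nu> a * subspace_dist p S y + e" .
qed

lemma subspace_dist_is_seminorm: "is_seminorm (subspace_dist p S)"
  unfolding is_seminorm_def
proof (intro conjI allI)
  fix x y
  show "subspace_dist p S (x + y) \<le> subspace_dist p S x + subspace_dist p S y"
  proof (rule field_le_epsilon)
    fix e :: real assume "e > 0"
    then obtain s s' where s: "s \<in> S" "s' \<in> S" "p (x - s) < subspace_dist p S x + e / 2"
        "p (y - s') < subspace_dist p S y + e / 2"
      using subspace_dist_less_iff[of x "subspace_dist p S x + e / 2"]
        subspace_dist_less_iff[of y "subspace_dist p S y + e / 2"] by auto
    have "subspace_dist p S (x + y) \<le> p (x + y - (s + s'))"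
      using s S by (intro subspace_dist_le) (auto simp: subspace_add)
    also have "\<dots> \<le> p (x - s) + p (y - s')"
      using seminorm_add[OF p, of "x - s" "y - s'"] by (simp add: algebra_simps)
    finally show "subspace_dist p S (x + y) \<le> subspace_dist p S x + subspace_dist p S y + e"
      using s by linarith
  qed
next
  fix a x
  show "subspace_dist p S (a \<cdot> x) = \<nu> a * subspace_dist p S x"
  proof (cases "a = 0")
    case True
    then show ?thesis
      using subspace_dist_scale_le[of a x] subspace_dist_nonneg[of "a \<cdot> x"]
      by (simp add: valuation valuation_0)
  next
    case False
    then have va: "0 < \<nu> a"
      using valuation valuation_nonneg[of \<nu> a] valuation_eq_0_iff[of \<nu> a] by simp
    have "subspace_dist p S (inverse a \<cdot> (a \<cdot> x)) \<le> inverse (\<nu> a) * subspace_dist p S (a \<cdot> x)"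
      using subspace_dist_scale_le[of "inverse a" "a \<cdot> x"]
      by (simp only: valuation_inverse[OF valuation])
    then have "\<nu> a * subspace_dist p S x \<le> subspace_dist p S (a \<cdot> x)"
      using False va by (simp add: field_simps)
    then show ?thesis
      using subspace_dist_scale_le[of a x] by linarith
  qed
qed

end

end

section \<open>Compatible topologies\<close>

context valued_vector_space
begin

context
  fixes T
  assumes T: "T \<in> compatible_topologies (val_topology \<nu>) scale"
begin

lemma compatible_topspace: "topspace T = UNIV"
  using T by (simp add: compatible_topologies_def)

lemma continuous_map_compatible_add:
  assumes "continuous_map X T f" "continuous_map X T g"
  shows "continuous_map X T (\<lambda>x. f x + g x)"
proof -
  have "continuous_map X T ((\<lambda>(x, y). x + y) \<circ> (\<lambda>x. (f x, g x)))"
    using T assms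
    by (intro continuous_map_compose[of _ "prod_topology T T"] continuous_map_pairedI)
      (auto simp: compatible_topologies_def)
  then show ?thesis
    by (simp add: o_def)
qed

lemma continuous_map_compatible_scale:
  assumes "continuous_map X (val_topology \<nu>) f" "continuous_map X T g"
  shows "continuous_map X T (\<lambda>x. f x \<cdot> g x)"
proof -
  have "continuous_map X T ((\<lambda>(a, y). a \<cdot> y) \<circ> (\<lambda>x. (f x, g x)))"
    using T assms
    by (intro continuous_map_compose[of _ "prod_topology (val_topology \<nu>) T"] continuous_map_pairedI)
      (auto simp: compatible_topologies_def)
  then show ?thesis
    by (simp add: o_def)
qed

lemma topspace_val_topology: "topspace (val_topology \<nu>) = UNIV"
  by (simp add: val_topology_eq_seminorm_topology valuation)

lemma openin_compatible_translate:
  assumes "openin T U"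
  shows "openin T {x. a + x \<in> U}"
proof -
  have "continuous_map T T (\<lambda>x. a + x)"
    by (intro continuous_map_compatible_add) (simp_all add: compatible_topspace)
  from openin_continuous_map_preimage[OF this assms] show ?thesis
    by (simp add: compatible_topspace)
qed

lemma openin_compatible_scale:
  assumes "openin T U"
  shows "openin T {x. c \<cdot> x \<in> U}"
proof -
  have "continuous_map T T (\<lambda>x. c \<cdot> x)"
    by (intro continuous_map_compatible_scale) (simp_all add: compatible_topspace topspace_val_topology)
  from openin_continuous_map_preimage[OF this assms] show ?thesis
    by (simp add: compatible_topspace)
qed

text \<open>Translations are continuous, so openness can be tested with neighbourhoods of 0:
  \<open>U\<close> moved to \<open>x\<close> is the preimage of \<open>U\<close> under translation
  by \<open>- x\<close>.\<close>

lemma openin_compatibleI: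
  assumes "\<And>x. x \<in> W \<Longrightarrow> \<exists>U. openin T U \<and> 0 \<in> U \<and> (\<forall>u\<in>U. x + u \<in> W)"
  shows "openin T W"
proof (subst openin_subopen, intro ballI)
  fix x assume "x \<in> W"
  then obtain U where U: "openin T U" "0 \<in> U" "\<forall>u\<in>U. x + u \<in> W"
    using assms by blast
  have "{y. - x + y \<in> U} \<subseteq> W"
  proof
    fix y assume "y \<in> {y. - x + y \<in> U}"
    then have "x + (- x + y) \<in> W"
      using U(3) by blast
    then show "y \<in> W"
      by (simp add: add.assoc[symmetric])
  qed
  then show "\<exists>V. openin T V \<and> x \<in> V \<and> V \<subseteq> W"
    using U openin_compatible_translate[OF U(1), of "- x"]
    by (intro exI[of _ "{y. - x + y \<in> U}"]) simp
qed

lemma compatible_add_nhd: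
  assumes U: "openin T U" "0 \<in> U"
  obtains V where "openin T V" "0 \<in> V" "\<And>x y. x \<in> V \<Longrightarrow> y \<in> V \<Longrightarrow> x + y \<in> U"
proof -
  have "continuous_map (prod_topology T T) T (\<lambda>(x, y). x + y)"
    using T by (simp add: compatible_topologies_def)
  from openin_continuous_map_preimage[OF this U(1)]
  have "openin (prod_topology T T) {(x, y). x + y \<in> U}"
    by (simp add: compatible_topspace case_prod_unfold)
  moreover have "(0, 0) \<in> {(x, y). x + y \<in> U}"
    using U by simp
  ultimately obtain V W where VW: "openin T V" "openin T W" "0 \<in> V" "0 \<in> W"
      "V \<times> W \<subseteq> {(x, y). x + y \<in> U}"
    unfolding openin_prod_topology_alt by meson
  show ?thesis
  proof (rule that[of "V \<inter> W"])
    fix x y assume "x \<in> V \<inter> W" "y \<in> V \<inter> W"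
    then have "(x, y) \<in> V \<times> W"
      by blast
    then show "x + y \<in> U"
      using VW(5) by blast
  qed (use VW in auto)
qed

text \<open>This is continuity of scalar multiplication at (0, x). It serves both for a vector
  \<open>x\<close> in a finite linear combination and, with \<open>x = 0\<close>, for scaling points
  down inside a neighbourhood.\<close>

lemma compatible_scale_nhd:
  assumes U: "openin T U" "0 \<in> U"
  obtains d V where "d > 0" "openin T V" "x \<in> V"
    "\<And>a y. \<nu> a < d \<Longrightarrow> y \<in> V \<Longrightarrow> a \<cdot> y \<in> U"
proof -
  have "continuous_map (prod_topology (val_topology \<nu>) T) T (\<lambda>(a, x). a \<cdot> x)"
    using T by (simp add: compatible_topologies_def)
  from openin_continuous_map_preimage[OF this U(1)]
  have "openin (prod_topology (val_topology \<nu>) T) {(a, x). a \<cdot> x \<in> U}"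
    by (simp add: compatible_topspace topspace_val_topology case_prod_unfold)
  moreover have "(0, x) \<in> {(a, x). a \<cdot> x \<in> U}"
    using U by simp
  ultimately obtain D V where DV: "openin (val_topology \<nu>) D" "openin T V" "0 \<in> D" "x \<in> V"
      "D \<times> V \<subseteq> {(a, x). a \<cdot> x \<in> U}"
    unfolding openin_prod_topology_alt by meson
  obtain d where d: "d > 0" "\<forall>a. \<nu> (a - 0) < d \<longrightarrow> a \<in> D"
    using DV(1,3) unfolding val_topology_eq_seminorm_topology[OF valuation] openin_seminorm_topology
    by blast
  show ?thesis
  proof (rule that[of d V])
    fix a y assume "\<nu> a < d" "y \<in> V"
    then have "(a, y) \<in> D \<times> V"
      using d by simp
    then show "a \<cdot> y \<in> U"
      using DV(5) by blast
  qed (use DV d in auto)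
qed

text \<open>Linear combinations depend continuously on their coefficients at 0; the induction splits
  off one summand after choosing \<open>V\<close> with V + V inside \<open>U\<close>. For a basis
  \<open>A\<close> this makes every compatible topology coarser than that of the coordinate
  norm.\<close>

lemma compatible_sum_nhd:
  assumes "finite A" "openin T U" "0 \<in> U"
  shows "\<exists>e>0. \<forall>c. (\<forall>b\<in>A. \<nu> (c b) < e) \<longrightarrow> (\<Sum>b\<in>A. c b \<cdot> b) \<in> U"
  using assms
proof (induction A arbitrary: U)
  case empty
  then show ?case
    by (auto intro: exI[of _ 1])
next
  case (insert b A)
  obtain V where V: "openin T V" "0 \<in> V" "\<And>x y. x \<in> V \<Longrightarrow> y \<in> V \<Longrightarrow> x + y \<in> U"
    using compatible_add_nhd[OF insert.prems] by blast
  obtain d W where d: "d > 0" "b \<in> W" "\<And>a y. \<nu> a < d \<Longrightarrow> y \<in> W \<Longrightarrow> a \<cdot> y \<in> V"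
    using compatible_scale_nhd[OF V(1,2), where x=b] by metis
  obtain e where e: "e > 0" "\<And>c. (\<forall>b\<in>A. \<nu> (c b) < e) \<Longrightarrow> (\<Sum>b\<in>A. c b \<cdot> b) \<in> V"
    using insert.IH[OF V(1,2)] by blast
  show ?case
  proof (intro exI[of _ "min d e"] conjI allI impI)
    fix c assume "\<forall>b'\<in>insert b A. \<nu> (c b') < min d e"
    then have "c b \<cdot> b \<in> V" "(\<Sum>b\<in>A. c b \<cdot> b) \<in> V"
      using d e(2) by auto
    then show "(\<Sum>b\<in>insert b A. c b \<cdot> b) \<in> U"
      using V(3) insert.hyps by simp
  qed (use d e in simp)
qed

text \<open>In the induction the new compact set is the image of the product of \<open>C\<close> and
  \<open>K\<close> under a continuous map.\<close>

lemma compact_combinations: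
  assumes "finite A" and C: "compactin (val_topology \<nu>) C"
  shows "\<exists>K. compactin T K \<and> (\<forall>c. (\<forall>b\<in>A. c b \<in> C) \<longrightarrow> (\<Sum>b\<in>A. c b \<cdot> b) \<in> K)"
  using assms(1)
proof induction
  case empty
  then show ?case
    by (intro exI[of _ "{0}"]) (simp add: compatible_topspace)
next
  case (insert b A)
  then obtain K where K: "compactin T K" "\<forall>c. (\<forall>b\<in>A. c b \<in> C) \<longrightarrow> (\<Sum>b\<in>A. c b \<cdot> b) \<in> K"
    by blast
  let ?f = "\<lambda>z. fst z \<cdot> b + snd z"
  have "continuous_map (prod_topology (val_topology \<nu>) T) T ?f"
    by (intro continuous_map_compatible_add continuous_map_compatible_scale continuous_map_fst
        continuous_map_snd) (simp add: compatible_topspace)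
  moreover have "compactin (prod_topology (val_topology \<nu>) T) (C \<times> K)"
    using C K(1) by (simp add: compactin_Times)
  ultimately have "compactin T (?f ` (C \<times> K))"
    by (rule image_compactin[rotated])
  moreover have "(\<Sum>b\<in>insert b A. c b \<cdot> b) \<in> ?f ` (C \<times> K)" if c: "\<forall>b\<in>insert b A. c b \<in> C" for c
  proof
    show "(c b, \<Sum>b\<in>A. c b \<cdot> b) \<in> C \<times> K"
      using c K(2) by simp
  qed (use insert.hyps in simp)
  ultimately show ?case
    by blast
qed

end

end

text \<open>Local compactness gives a compact set containing a small ball around 0. Multiplication
  by \<open>inverse (c ^ n)\<close>, with \<open>\<nu> c < 1\<close> and \<open>n\<close> large,
  stretches it over the ball of radius \<open>r\<close>.\<close>

lemma compactin_val_ball: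
  assumes "nontrivial_valuation \<nu>" "locally_compact_space (val_topology \<nu>)"
  shows "\<exists>C. compactin (val_topology \<nu>) C \<and> {a. \<nu> a \<le> r} \<subseteq> C"
proof -
  have val: "valuation \<nu>"
    using assms(1) by (simp add: nontrivial_valuation_def)
  \<comment> \<open>The field is viewed as a vector space over itself, so that continuity of
    multiplication becomes an instance of compatibility.\<close>
  interpret K: valued_vector_space "(*)" \<nu>
    by unfold_locales (simp_all add: algebra_simps val)
  have "K.is_seminorm \<nu>"
    by (simp add: K.is_seminorm_def valuation_add valuation_mult val)
  then have comp: "val_topology \<nu> \<in> compatible_topologies (val_topology \<nu>) (*)"
    using K.seminorm_topology_compatible by (simp add: val_topology_eq_seminorm_topology val)
  have top: "topspace (val_topology \<nu>) = UNIV"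
    by (simp add: val_topology_eq_seminorm_topology val)
  obtain U C where UC: "openin (val_topology \<nu>) U" "compactin (val_topology \<nu>) C" "0 \<in> U" "U \<subseteq> C"
    using assms(2) top unfolding locally_compact_space_def by (metis UNIV_I)
  obtain e where e: "e > 0" "\<forall>a. \<nu> (a - 0) < e \<longrightarrow> a \<in> U"
    using UC(1,3) unfolding val_topology_eq_seminorm_topology[OF val] openin_seminorm_topology
    by blast
  obtain c where c: "0 < \<nu> c" "\<nu> c < 1"
    using nontrivial_valuation_small[OF assms(1)] by blast
  obtain n where n: "\<nu> c ^ n < e / (\<bar>r\<bar> + 1)"
    using real_arch_pow_inv[of "e / (\<bar>r\<bar> + 1)" "\<nu> c"] e c by auto
  have "c \<noteq> 0"
    using c valuation_0[OF val] by auto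
  have "continuous_map (val_topology \<nu>) (val_topology \<nu>) (\<lambda>a. inverse (c ^ n) * a)"
    by (intro K.continuous_map_compatible_scale[OF comp]) (simp_all add: top)
  then have "compactin (val_topology \<nu>) ((\<lambda>a. inverse (c ^ n) * a) ` C)"
    using UC(2) by (intro image_compactin)
  moreover have "a \<in> (\<lambda>a. inverse (c ^ n) * a) ` C" if "\<nu> a \<le> r" for a
  proof
    have "\<nu> (c ^ n * a) = \<nu> c ^ n * \<nu> a"
      by (simp add: valuation_mult valuation_power val)
    also have "\<dots> \<le> \<nu> c ^ n * (\<bar>r\<bar> + 1)"
      using c that by (intro mult_left_mono) auto
    also have "\<dots> < e"
      using n by (simp add: field_simps)
    finally show "c ^ n * a \<in> C"
      using e UC(4) by auto
  qed (use \<open>c \<noteq> 0\<close> in simp)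
  ultimately show ?thesis
    by blast
qed

lemma topology_subset_antisym:
  assumes "topology_subset T T'" "topology_subset T' T"
  shows "T = T'"
  using assms unfolding topology_subset_def topology_eq by blast

section \<open>Finite-dimensional spaces\<close>

locale finite_dimensional_valued_space =
  valued_vector_space scale \<nu> + finite_dimensional_vector_space scale Basis
  for scale :: "'k::field \<Rightarrow> 'z::ab_group_add \<Rightarrow> 'z" (infixr \<open>\<cdot>\<close> 75)
    and \<nu> Basis
begin

abbreviation coord :: "'z \<Rightarrow> 'z \<Rightarrow> 'k"
  where "coord \<equiv> representation Basis"

lemma sum_coord: "(\<Sum>b\<in>Basis. coord x b \<cdot> b) = x"
  by (rule sum_representation_eq) (simp_all add: independent_Basis span_Basis finite_Basis)

definition coord_norm :: "'z \<Rightarrow> real"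
  where "coord_norm x = (\<Sum>b\<in>Basis. \<nu> (coord x b))"

lemma coord_norm_is_seminorm: "is_seminorm coord_norm"
  unfolding is_seminorm_def
proof (intro conjI allI)
  fix x y
  have "coord_norm (x + y) = (\<Sum>b\<in>Basis. \<nu> (coord x b + coord y b))"
    by (simp add: coord_norm_def representation_add independent_Basis span_Basis)
  also have "\<dots> \<le> (\<Sum>b\<in>Basis. \<nu> (coord x b) + \<nu> (coord y b))"
    by (intro sum_mono valuation_add valuation)
  finally show "coord_norm (x + y) \<le> coord_norm x + coord_norm y"
    by (simp add: coord_norm_def sum.distrib)
next
  fix a x
  show "coord_norm (a \<cdot> x) = \<nu> a * coord_norm x"
    by (simp add: coord_norm_def representation_scale independent_Basis span_Basis
        valuation_mult valuation sum_distrib_left)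
qed

lemma coord_le_coord_norm: "b \<in> Basis \<Longrightarrow> \<nu> (coord x b) \<le> coord_norm x"
  unfolding coord_norm_def
  by (rule member_le_sum) (auto simp: finite_Basis valuation valuation_nonneg)

lemma compatible_nhd_coord_norm:
  assumes "T \<in> compatible_topologies (val_topology \<nu>) scale" "openin T U" "0 \<in> U"
  obtains e where "e > 0" "\<And>x. coord_norm x < e \<Longrightarrow> x \<in> U"
proof -
  obtain e where e: "e > 0" "\<And>c. (\<forall>b\<in>Basis. \<nu> (c b) < e) \<Longrightarrow> (\<Sum>b\<in>Basis. c b \<cdot> b) \<in> U"
    using compatible_sum_nhd[OF assms(1) finite_Basis assms(2,3)] by blast
  show ?thesis
  proof (rule that[OF e(1)])
    fix x assume "coord_norm x < e"
    then have "\<forall>b\<in>Basis. \<nu> (coord x b) < e"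
      using coord_le_coord_norm by (meson order_le_less_trans)
    then show "x \<in> U"
      using e(2)[of "coord x"] by (simp add: sum_coord)
  qed
qed

lemma max_compatible_topology_eq:
  "max_compatible_topology (val_topology \<nu>) scale = seminorm_topology coord_norm"
proof -
  let ?L = "compatible_order (val_topology \<nu>) scale"
  let ?N = "seminorm_topology coord_norm"
  have N: "?N \<in> compatible_topologies (val_topology \<nu>) scale"
    by (rule seminorm_topology_compatible[OF coord_norm_is_seminorm])
  have sub: "topology_subset T ?N" if T: "T \<in> compatible_topologies (val_topology \<nu>) scale" for T
    unfolding topology_subset_def
  proof clarify
    fix U assume U: "openin T U"
    show "openin ?N U"
      unfolding openin_seminorm_topology
    proof
      fix x assume "x \<in> U"
      then obtain e where "e > 0" "\<And>z. coord_norm z < e \<Longrightarrow> z \<in> {z. x + z \<in> U}"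
        using compatible_nhd_coord_norm[OF T openin_compatible_translate[OF T U], of x] by auto
      then show "\<exists>e>0. \<forall>z. coord_norm (z - x) < e \<longrightarrow> z \<in> U"
        by (intro exI[of _ e]) fastforce
    qed
  qed
  have "greatest ?L ?N (carrier ?L)"
    using N sub by (simp add: greatest_def compatible_order_def)
  \<comment> \<open>The top element is defined by choice, so identifying it needs uniqueness of the
    greatest element.\<close>
  moreover have "T = ?N" if "greatest ?L T (carrier ?L)" for T
    using that N sub
    by (intro topology_subset_antisym) (simp_all add: greatest_def compatible_order_def)
  ultimately show ?thesis
    unfolding max_compatible_topology_def top_def by (rule some_equality)
qed

text \<open>A point outside \<open>S\<close> is separated from \<open>S\<close> by a linear functional vanishing on \<open>S\<close>, and every
  linear functional is bounded.\<close>

lemma subspace_dist_pos: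
  assumes S: "subspace S" and y: "y \<notin> S"
  shows "0 < subspace_dist coord_norm S y"
proof -
  obtain C where C: "C \<subseteq> S" "independent C" "S \<subseteq> span C"
    using maximal_independent_subset by blast
  then have spanC: "span C = S"
    using S by (simp add: span_minimal subset_antisym)
  \<comment> \<open>A basis of \<open>S\<close> together with \<open>y\<close> extends to a basis of
    the whole space; the coordinate along \<open>y\<close> is the required functional.\<close>
  define D where "D = extend_basis (insert y C)"
  have ind: "independent (insert y C)"
    using C y spanC by (simp add: independent_insert)
  have D: "independent D" "span D = UNIV" "insert y C \<subseteq> D"
    using ind extend_basis_superset[OF ind]
    by (simp_all add: D_def independent_extend_basis span_extend_basis)
  define g where "g v = representation D v y" for v
  interpret g: Vector_Spaces.linear scale "(*)" g
    unfolding g_def using D by (intro linear_representation)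
  have "y \<notin> C"
    using C y by blast
  have gS: "g s = 0" if "s \<in> S" for s
  proof -
    have "representation D s = representation C s"
      using D that spanC by (intro representation_extend) auto
    then show ?thesis
      using representation_ne_zero[of C s y] \<open>y \<notin> C\<close> by (auto simp: g_def)
  qed
  have gy: "g y = 1"
    using D by (simp add: g_def representation_basis)
  define M where "M = (\<Sum>b\<in>Basis. \<nu> (g b))"
  have nn: "0 \<le> \<nu> a" for a
    by (simp add: valuation valuation_nonneg)
  then have M: "0 \<le> M"
    by (simp add: M_def sum_nonneg)
  have bound: "\<nu> (g v) \<le> coord_norm v * M" for v
  proof -
    have val_sum: "\<nu> (sum h A) \<le> (\<Sum>b\<in>A. \<nu> (h b))" if "finite A" for h :: "'z \<Rightarrow> 'k" and A
      using that
    proof induction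
      case (insert b A)
      then show ?case
        using valuation_add[OF valuation, of "h b" "sum h A"] by simp
    qed (simp add: valuation valuation_0)
    have "g v = g (\<Sum>b\<in>Basis. coord v b \<cdot> b)"
      by (simp only: sum_coord)
    also have "\<dots> = (\<Sum>b\<in>Basis. coord v b * g b)"
      by (simp add: g.sum g.scale)
    finally have "\<nu> (g v) \<le> (\<Sum>b\<in>Basis. \<nu> (coord v b) * \<nu> (g b))"
      using val_sum[OF finite_Basis, of "\<lambda>b. coord v b * g b"]
      by (simp add: valuation_mult valuation)
    also have "\<dots> \<le> (\<Sum>b\<in>Basis. coord_norm v * \<nu> (g b))"
      by (intro sum_mono mult_right_mono coord_le_coord_norm nn)
    finally show ?thesis
      by (simp add: M_def sum_distrib_left)
  qed
  \<comment> \<open>For \<open>s\<close> in \<open>S\<close>,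
    \<open>1 = \<nu> (g (y - s)) \<le> coord_norm (y - s) * M\<close>. The denominator
    \<open>M + 1\<close> is positive without first showing that \<open>M\<close> is.\<close>
  have "1 / (M + 1) \<le> subspace_dist coord_norm S y"
  proof (rule ccontr)
    assume "\<not> ?thesis"
    then obtain s where s: "s \<in> S" "coord_norm (y - s) < 1 / (M + 1)"
      using subspace_dist_less_iff[OF coord_norm_is_seminorm S, of y "1 / (M + 1)"] by auto
    have "1 = \<nu> (g (y - s))"
      using s by (simp add: g.diff gS gy valuation valuation_1)
    also have "\<dots> \<le> 1 / (M + 1) * M"
      using s M by (intro order_trans[OF bound] mult_right_mono) auto
    also have "\<dots> < 1"
      using M by simp
    finally show False
      by simp
  qed
  then show ?thesis
    using M by (meson add_nonneg_pos divide_pos_pos less_le_trans zero_less_one)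
qed

text \<open>All coordinates of a point in the ball have value at most \<open>r\<close>, so the point
  is a combination of basis vectors with coefficients in one compact set.\<close>

lemma compactin_coord_ball:
  assumes "nontrivial_valuation \<nu>" "locally_compact_space (val_topology \<nu>)"
  obtains K where "compactin (seminorm_topology coord_norm) K" "{x. coord_norm x \<le> r} \<subseteq> K"
proof -
  obtain C where C: "compactin (val_topology \<nu>) C" "{a. \<nu> a \<le> r} \<subseteq> C"
    using compactin_val_ball[OF assms] by blast
  obtain K where K: "compactin (seminorm_topology coord_norm) K"
      "\<And>c. (\<forall>b\<in>Basis. c b \<in> C) \<Longrightarrow> (\<Sum>b\<in>Basis. c b \<cdot> b) \<in> K"
    using compact_combinations[OF seminorm_topology_compatible[OF coord_norm_is_seminorm]
        finite_Basis C(1)] by blast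
  show ?thesis
  proof (rule that[OF K(1)], clarify)
    fix x assume "coord_norm x \<le> r"
    then have "\<forall>b\<in>Basis. coord x b \<in> C"
      using C(2) coord_le_coord_norm order_trans by blast
    then show "x \<in> K"
      using K(2)[of "coord x"] by (simp add: sum_coord)
  qed
qed

end

section \<open>The completed tensor product\<close>

lemma
  assumes "vector_space sY"
  shows tensor_eval_add: "tensor_eval sY t (f + g) = tensor_eval sY t f + tensor_eval sY t g"
    and tensor_eval_diff: "tensor_eval sY t (f - g) = tensor_eval sY t f - tensor_eval sY t g"
    and tensor_eval_frag_of: "tensor_eval sY t (frag_of (a, x)) = t a x"
    and tensor_eval_0: "tensor_eval sY t 0 = 0"
proof -
  interpret vector_space sY by fact
  \<comment> \<open>The supports of \<open>f\<close>, \<open>g\<close> and their sum may differ, so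
    all sums are moved to a common finite index set; the added terms have coefficient 0.\<close>
  have superset: "tensor_eval sY t f = (\<Sum>(a, x)\<in>A. sY (of_int (Poly_Mapping.lookup f (a, x))) (t a x))"
    if "finite A" "Poly_Mapping.keys f \<subseteq> A" for f A
    unfolding tensor_eval_def
    using that by (intro sum.mono_neutral_left) (auto simp: in_keys_iff)
  let ?A = "Poly_Mapping.keys f \<union> Poly_Mapping.keys g"
  have f: "Poly_Mapping.keys f \<subseteq> ?A" and g: "Poly_Mapping.keys g \<subseteq> ?A" and fin: "finite ?A"
    by auto
  show "tensor_eval sY t (f + g) = tensor_eval sY t f + tensor_eval sY t g"
    using Poly_Mapping.keys_add[of f g]
    by (simp add: superset[OF fin f] superset[OF fin g] superset[OF fin, of "f + g"]
        lookup_add scale_left_distrib case_prod_unfold flip: sum.distrib)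
  show "tensor_eval sY t (f - g) = tensor_eval sY t f - tensor_eval sY t g"
    using Poly_Mapping.keys_diff[of f g]
    by (simp add: superset[OF fin f] superset[OF fin g] superset[OF fin, of "f - g"]
        lookup_minus scale_left_diff_distrib case_prod_unfold flip: sum_subtractf)
  show "tensor_eval sY t (frag_of (a, x)) = t a x"
    by (simp add: tensor_eval_def)
  show "tensor_eval sY t 0 = 0"
    by (simp add: tensor_eval_def)
qed

lemma tensor_eval_sum_frag_of:
  assumes "vector_space sY" "finite A"
  shows "tensor_eval sY t (\<Sum>i\<in>A. frag_of (c i, h i)) = (\<Sum>i\<in>A. t (c i) (h i))"
  using assms(2)
  by induction (simp_all add: tensor_eval_add tensor_eval_frag_of tensor_eval_0 assms(1))

text \<open>This is the part of the universal property by which a biadditive balanced map descends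
  to the tensor product.\<close>

lemma tensor_eval_relations:
  assumes "vector_space sY"
    and "\<And>a b x. u (a + b) x = u a x + u b x" "\<And>a x y. u a (x + y) = u a x + u a y"
    and "\<And>a c x. u (a * \<iota> c) x = u a (sX c x)"
    and "f \<in> tensor_relations \<iota> sX"
  shows "tensor_eval sY u f = 0"
  using assms(5)
  by induction
    (simp_all add: tensor_eval_diff tensor_eval_frag_of tensor_eval_0 assms(1-4))

section \<open>Extension of scalars in coordinates\<close>

locale completed_tensor_product =
  X: finite_dimensional_vector_space sX B
  for sX :: "'k::field \<Rightarrow> 'x::ab_group_add \<Rightarrow> 'x" and B +
  fixes \<nu> :: "'k \<Rightarrow> real"
    and \<nu>' :: "'l::field \<Rightarrow> real"
    and \<iota> :: "'k \<Rightarrow> 'l"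
    and sY :: "'l \<Rightarrow> 'y::ab_group_add \<Rightarrow> 'y"
    and t :: "'l \<Rightarrow> 'x \<Rightarrow> 'y"
  assumes nontrivial: "nontrivial_valuation \<nu>"
    and completion: "valuation_completion \<nu> \<nu>' \<iota>"
    and tensor: "is_tensor_product \<iota> sX sY t"
begin

lemma valuation_base: "valuation \<nu>"
  and valuation_hat: "valuation \<nu>'"
  and iota_1: "\<iota> 1 = 1"
  and iota_add: "\<iota> (a + b) = \<iota> a + \<iota> b"
  and iota_mult: "\<iota> (a * b) = \<iota> a * \<iota> b"
  and valuation_iota: "\<nu>' (\<iota> a) = \<nu> a"
  using completion by (auto simp: valuation_completion_def)

lemma iota_0: "\<iota> 0 = 0"
  using iota_add[of 0 0] by (metis add_0 add_cancel_right_right)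

lemma vector_space_tensor: "vector_space sY"
  and scale_tensor: "sY c (t a x) = t (c * a) x"
  and surj_tensor_eval: "surj (tensor_eval sY t)"
  and tensor_eval_eq_0_iff: "tensor_eval sY t f = 0 \<longleftrightarrow> f \<in> tensor_relations \<iota> sX"
  using tensor by (auto simp: is_tensor_product_def)

lemma tensor_add_right: "t a (x + y) = t a x + t a y"
  and tensor_balanced: "t (a * \<iota> c) x = t a (sX c x)"
proof -
  note eval = tensor_eval_diff[OF vector_space_tensor] tensor_eval_frag_of[OF vector_space_tensor]
  show "t a (x + y) = t a x + t a y"
    using tensor_eval_eq_0_iff[of "frag_of (a, x + y) - frag_of (a, x) - frag_of (a, y)"]
    by (simp add: tensor_relations.intros eval) (simp add: algebra_simps)
  show "t (a * \<iota> c) x = t a (sX c x)"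
    using tensor_eval_eq_0_iff[of "frag_of (a * \<iota> c, x) - frag_of (a, sX c x)"]
    by (simp add: tensor_relations.intros eval)
qed

lemma embed_add: "t 1 (x + y) = t 1 x + t 1 y"
  by (rule tensor_add_right)

lemma embed_0: "t 1 0 = 0"
  using embed_add[of 0 0] by simp

lemma embed_diff: "t 1 (x - y) = t 1 x - t 1 y"
  using embed_add[of "x - y" y] by (simp add: algebra_simps)

lemma embed_scale: "t 1 (sX c x) = sY (\<iota> c) (t 1 x)"
  using tensor_balanced[of 1 c x] by (simp add: scale_tensor)

lemma tensor_sum_right: "finite A \<Longrightarrow> t a (\<Sum>i\<in>A. h i) = (\<Sum>i\<in>A. t a (h i))"
proof (induction rule: finite_induct)
  case empty
  then show ?case
    using tensor_add_right[of a 0 0] by simp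
qed (simp add: tensor_add_right)

text \<open>The map \<open>\<lambda>a x. a * \<iota> (X.representation B x b)\<close> is biadditive
  and balanced. For a basis vector \<open>b\<close> it induces the coordinate along
  \<open>t 1 b\<close> on Y, here expressed on formal sums.\<close>

lemma tensor_eval_coord:
  assumes "tensor_eval sY t f = 0"
  shows "tensor_eval (*) (\<lambda>a x. a * \<iota> (X.representation B x b)) f = 0"
proof (rule tensor_eval_relations)
  show "vector_space ((*) :: 'l \<Rightarrow> _)"
    by unfold_locales (simp_all add: algebra_simps)
  show "f \<in> tensor_relations \<iota> sX"
    using assms by (simp add: tensor_eval_eq_0_iff)
qed (simp_all add: X.representation_add X.representation_scale X.independent_Basis X.span_Basis
    iota_add iota_mult algebra_simps)

text \<open>The coordinate map for \<open>d\<close>, evaluated on the formal sum that represents the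
  combination, returns \<open>c d\<close>.\<close>

lemma coord_eq_0_of_sum_eq_0:
  assumes "(\<Sum>b\<in>B. sY (c b) (t 1 b)) = 0" "d \<in> B"
  shows "c d = 0"
proof -
  let ?f = "\<Sum>b\<in>B. frag_of (c b, b)"
  have vs: "vector_space ((*) :: 'l \<Rightarrow> _)"
    by unfold_locales (simp_all add: algebra_simps)
  have "tensor_eval sY t ?f = 0"
    using assms(1)
    by (simp add: tensor_eval_sum_frag_of vector_space_tensor X.finite_Basis scale_tensor)
  then have "(\<Sum>b\<in>B. c b * \<iota> (X.representation B b d)) = 0"
    using tensor_eval_coord[of ?f d] by (simp add: tensor_eval_sum_frag_of vs X.finite_Basis)
  moreover have "c b * \<iota> (X.representation B b d) = (if b = d then c b else 0)" if "b \<in> B" for b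
    using that by (simp add: X.representation_basis X.independent_Basis iota_0 iota_1)
  ultimately have "(\<Sum>b\<in>B. if b = d then c b else 0) = 0"
    by simp
  then show ?thesis
    using assms(2) by (simp add: X.finite_Basis)
qed

lemma inj_on_embed_Basis: "inj_on (t 1) B"
proof
  interpret vector_space sY by (rule vector_space_tensor)
  fix b b' assume b: "b \<in> B" "b' \<in> B" "t 1 b = t 1 b'"
  show "b = b'"
  proof (rule ccontr)
    assume "b \<noteq> b'"
    \<comment> \<open>Two basis vectors with the same image would give a vanishing combination with
      coefficients 1 and -1.\<close>
    let ?c = "\<lambda>d. if d = b then 1 else if d = b' then -1 else 0"
    have "(\<Sum>d\<in>B. sY (?c d) (t 1 d)) = (\<Sum>d\<in>{b, b'}. sY (?c d) (t 1 d))"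
      using b by (intro sum.mono_neutral_right) (auto simp: X.finite_Basis)
    also have "\<dots> = 0"
      using b \<open>b \<noteq> b'\<close> by simp
    finally show False
      using coord_eq_0_of_sum_eq_0[of ?c b] b by simp
  qed
qed

text \<open>For the span, expanding \<open>x\<close> in \<open>B\<close> and moving the scalars to
  the left factor reaches every pure tensor; sums of pure tensors exhaust Y.\<close>

lemma finite_dimensional_tensor: "finite_dimensional_vector_space sY (t 1 ` B)"
proof -
  interpret vector_space sY by (rule vector_space_tensor)
  have "independent (t 1 ` B)"
  proof (rule independent_if_scalars_zero)
    fix c y assume "(\<Sum>y\<in>t 1 ` B. sY (c y) y) = 0" "y \<in> t 1 ` B"
    then show "c y = 0"
      using coord_eq_0_of_sum_eq_0[of "\<lambda>b. c (t 1 b)"] by (auto simp: sum.reindex inj_on_embed_Basis)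
  qed (simp add: X.finite_Basis)
  moreover have pure: "t a x \<in> span (t 1 ` B)" for a x
  proof -
    have "x = (\<Sum>b\<in>B. sX (X.representation B x b) b)"
      by (simp add: X.sum_representation_eq X.independent_Basis X.span_Basis X.finite_Basis)
    then have "t a x = t a (\<Sum>b\<in>B. sX (X.representation B x b) b)"
      by simp
    also have "\<dots> = (\<Sum>b\<in>B. sY (a * \<iota> (X.representation B x b)) (t 1 b))"
      by (simp add: tensor_sum_right X.finite_Basis scale_tensor tensor_balanced)
    also have "\<dots> \<in> span (t 1 ` B)"
      by (intro span_sum span_scale span_base imageI)
    finally show ?thesis .
  qed
  have "y \<in> span (t 1 ` B)" for y
  proof -
    obtain f where "y = tensor_eval sY t f"
      using surj_tensor_eval by blast
    then show ?thesis
      unfolding tensor_eval_def by (auto intro!: span_sum span_scale pure)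
  qed
  ultimately show ?thesis
    by unfold_locales (auto simp: X.finite_Basis)
qed

sublocale X: finite_dimensional_valued_space sX \<nu> B
  by unfold_locales (rule valuation_base)

sublocale Y: finite_dimensional_valued_space sY \<nu>' "t 1 ` B"
  by (intro finite_dimensional_valued_space.intro valued_vector_space.intro
      valued_vector_space_axioms.intro finite_dimensional_tensor vector_space_tensor valuation_hat)

lemma embed_combination: "t 1 (\<Sum>b\<in>B. sX (c b) b) = (\<Sum>b\<in>B. sY (\<iota> (c b)) (t 1 b))"
  by (simp add: tensor_sum_right X.finite_Basis embed_scale)

lemma coord_embed:
  assumes "d \<in> B"
  shows "Y.coord (t 1 x) (t 1 d) = \<iota> (X.coord x d)"
proof -
  have "t 1 x = (\<Sum>b\<in>B. sY (\<iota> (X.coord x b)) (t 1 b))"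
    using embed_combination[of "X.coord x"] by (simp add: X.sum_coord)
  then have "Y.coord (t 1 x) (t 1 d) = (\<Sum>b\<in>B. \<iota> (X.coord x b) * Y.coord (t 1 b) (t 1 d))"
    by (simp add: Y.representation_sum Y.representation_scale Y.independent_Basis Y.span_Basis)
  also have "\<dots> = (\<Sum>b\<in>B. if b = d then \<iota> (X.coord x b) else 0)"
  proof (intro sum.cong refl)
    fix b assume b: "b \<in> B"
    then have "t 1 b = t 1 d \<longleftrightarrow> b = d"
      using assms inj_on_embed_Basis by (auto dest: inj_onD)
    then show "\<iota> (X.coord x b) * Y.coord (t 1 b) (t 1 d) = (if b = d then \<iota> (X.coord x b) else 0)"
      using b by (cases "b = d") (simp_all add: Y.representation_basis Y.independent_Basis)
  qed
  finally show ?thesis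
    using assms by (simp add: X.finite_Basis)
qed

text \<open>This transfers smallness in Y back to X, where it yields membership in neighbourhoods of
  0 for compatible topologies.\<close>

lemma coord_norm_embed: "Y.coord_norm (t 1 x) = X.coord_norm x"
  by (simp add: Y.coord_norm_def X.coord_norm_def sum.reindex inj_on_embed_Basis coord_embed
      valuation_iota)

lemma iota_dense:
  assumes "e > 0"
  obtains c where "\<nu>' (\<iota> c - a) < e"
proof -
  interpret L: valued_vector_space "(*)" \<nu>'
    by unfold_locales (simp_all add: algebra_simps valuation_hat)
  have "L.is_seminorm \<nu>'"
    by (simp add: L.is_seminorm_def valuation_add valuation_mult valuation_hat)
  moreover have "a \<in> seminorm_topology \<nu>' closure_of range \<iota>"
    using completion val_topology_eq_seminorm_topology[OF valuation_hat]
    by (simp add: valuation_completion_def)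
  ultimately have "\<forall>e>0. \<exists>c\<in>range \<iota>. \<nu>' (c - a) < e"
    using L.in_closure_of_seminorm_topology by blast
  then show ?thesis
    using assms that by blast
qed

abbreviation N :: "'y \<Rightarrow> real"
  where "N \<equiv> Y.coord_norm"

lemmas N_seminorm = Y.coord_norm_is_seminorm

text \<open>Each coordinate of \<open>y\<close> is approximated from the dense subfield;
  \<open>compatible_sum_nhd\<close>, applied to the norm topology of Y, provides one tolerance
  \<open>d\<close> for all coordinates.\<close>

lemma embed_dense:
  assumes "e > 0"
  obtains x where "N (t 1 x - y) < e"
proof -
  have "0 \<in> {z. N (z - 0) < e}"
    using assms by (simp add: Y.seminorm_0[OF N_seminorm])
  from Y.compatible_sum_nhd[OF Y.seminorm_topology_compatible[OF N_seminorm] Y.finite_Basis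
      Y.openin_seminorm_ball[OF N_seminorm] this]
  obtain d where d: "d > 0" "\<And>c. (\<forall>b\<in>t 1 ` B. \<nu>' (c b) < d) \<Longrightarrow> N (\<Sum>b\<in>t 1 ` B. sY (c b) b) < e"
    by auto
  have "\<forall>b. \<exists>c. \<nu>' (\<iota> c - Y.coord y b) < d"
    using iota_dense[OF d(1)] by meson
  then obtain c where c: "\<And>b. \<nu>' (\<iota> (c b) - Y.coord y b) < d"
    by metis
  show ?thesis
  proof (rule that)
    have "t 1 (\<Sum>b\<in>B. sX (c (t 1 b)) b) = (\<Sum>b\<in>t 1 ` B. sY (\<iota> (c b)) b)"
      by (simp add: embed_combination[of "\<lambda>b. c (t 1 b)"] sum.reindex inj_on_embed_Basis)
    then have "t 1 (\<Sum>b\<in>B. sX (c (t 1 b)) b) - y = (\<Sum>b\<in>t 1 ` B. sY (\<iota> (c b) - Y.coord y b) b)"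
      by (simp add: Y.scale_left_diff_distrib sum_subtractf Y.sum_coord)
    then show "N (t 1 (\<Sum>b\<in>B. sX (c (t 1 b)) b) - y) < e"
      using d(2) c by simp
  qed
qed

section \<open>The two maps between topologies and subspaces\<close>

abbreviation "\<tau> \<equiv> compatible_topologies (val_topology \<nu>) sX"
abbreviation "\<sigma> \<equiv> subspaces sY"
abbreviation "F \<equiv> F_hat \<nu>' sY t"
abbreviation "G \<equiv> G_hat \<nu>' sY t"
abbreviation "q S \<equiv> Y.subspace_dist N S"

lemma in_F_iff:
  "y \<in> F T \<longleftrightarrow> (\<forall>U. openin T U \<longrightarrow> 0 \<in> U \<longrightarrow> (\<forall>e>0. \<exists>u\<in>U. N (t 1 u - y) < e))"
  unfolding F_hat_def Y.max_compatible_topology_eq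
  by (auto simp: Y.in_closure_of_seminorm_topology[OF N_seminorm])

lemma F_antimono: "topology_subset T T' \<Longrightarrow> F T' \<subseteq> F T"
  unfolding topology_subset_def subset_iff in_F_iff by blast

lemma F_subspace:
  assumes T: "T \<in> \<tau>"
  shows "F T \<in> \<sigma>"
  unfolding subspaces_def
proof (rule CollectI, rule Y.subspaceI)
  show "0 \<in> F T"
    unfolding in_F_iff
    by (intro allI impI bexI[of _ 0]) (simp_all add: embed_0 Y.seminorm_0[OF N_seminorm])
next
  fix y z assume yz: "y \<in> F T" "z \<in> F T"
  show "y + z \<in> F T"
    unfolding in_F_iff
  proof (intro allI impI)
    fix U and e :: real assume U: "openin T U" "0 \<in> U" and "e > 0"
    obtain V where V: "openin T V" "0 \<in> V" "\<And>x y. x \<in> V \<Longrightarrow> y \<in> V \<Longrightarrow> x + y \<in> U"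
      using X.compatible_add_nhd[OF T U] by blast
    obtain u v where uv: "u \<in> V" "N (t 1 u - y) < e / 2" "v \<in> V" "N (t 1 v - z) < e / 2"
      using yz V(1,2) \<open>e > 0\<close> unfolding in_F_iff by (meson half_gt_zero)
    have "N (t 1 (u + v) - (y + z)) < e"
      using Y.seminorm_add[OF N_seminorm, of "t 1 u - y" "t 1 v - z"] uv
      by (simp add: embed_add algebra_simps)
    then show "\<exists>w\<in>U. N (t 1 w - (y + z)) < e"
      using V(3) uv by blast
  qed
next
  fix a y assume y: "y \<in> F T"
  show "sY a y \<in> F T"
    unfolding in_F_iff
  proof (intro allI impI)
    fix U and e :: real assume U: "openin T U" "0 \<in> U" and "e > 0"
    have Ny: "0 \<le> N y"
      by (rule Y.seminorm_nonneg[OF N_seminorm])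
    \<comment> \<open>X has no multiplication by \<open>a\<close>, so \<open>a\<close> is
      approximated by \<open>\<iota> c\<close>, and \<open>y \<in> F T\<close> is used for the
      preimage of \<open>U\<close> under multiplication by \<open>c\<close>.\<close>
    obtain c where c: "\<nu>' (\<iota> c - a) < e / (2 * (N y + 1))"
      using iota_dense[of "e / (2 * (N y + 1))" a] \<open>e > 0\<close> Ny by auto
    have nc: "0 \<le> \<nu> c"
      by (rule valuation_nonneg[OF valuation_base])
    have "openin T {x. sX c x \<in> U}" "0 \<in> {x. sX c x \<in> U}"
      using U X.openin_compatible_scale[OF T] by auto
    moreover have "0 < e / (2 * (\<nu> c + 1))"
      using \<open>e > 0\<close> nc by simp
    ultimately obtain x where x: "sX c x \<in> U" "N (t 1 x - y) < e / (2 * (\<nu> c + 1))"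
      using y unfolding in_F_iff by blast
    have "t 1 (sX c x) - sY a y = sY (\<iota> c) (t 1 x - y) + sY (\<iota> c - a) y"
      by (simp add: embed_scale Y.scale_right_diff_distrib Y.scale_left_diff_distrib)
    then have "N (t 1 (sX c x) - sY a y) \<le> \<nu> c * N (t 1 x - y) + \<nu>' (\<iota> c - a) * N y"
      by (metis Y.seminorm_add[OF N_seminorm] Y.seminorm_scale[OF N_seminorm] valuation_iota)
    also have "\<nu> c * N (t 1 x - y) \<le> \<nu> c * (e / (2 * (\<nu> c + 1)))"
      using nc x by (intro mult_left_mono) auto
    also have "\<dots> < e / 2"
      using nc \<open>e > 0\<close> by (simp add: field_simps)
    also have "\<nu>' (\<iota> c - a) * N y \<le> e / (2 * (N y + 1)) * N y"
      using c Ny by (intro mult_right_mono) auto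
    also have "\<dots> \<le> e / 2"
      using Ny \<open>e > 0\<close> by (simp add: field_simps)
    finally have "N (t 1 (sX c x) - sY a y) < e"
      by simp
    then show "\<exists>w\<in>U. N (t 1 w - sY a y) < e"
      using x by blast
  qed
qed

context
  fixes S
  assumes S: "S \<in> \<sigma>"
begin

lemma subspace_S: "Y.subspace S"
  using S by (simp add: subspaces_def)

lemmas q_seminorm = Y.subspace_dist_is_seminorm[OF N_seminorm subspace_S]
lemmas q_less_iff = Y.subspace_dist_less_iff[OF N_seminorm subspace_S]

lemma q_le_N: "q S y \<le> N y"
  using Y.subspace_dist_le[OF N_seminorm subspace_S, of 0 y] by (simp add: Y.subspace_0 subspace_S)

text \<open>The forward direction is closedness of \<open>S\<close>, which rests on the separating
  functional behind \<open>subspace_dist_pos\<close>.\<close>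

lemma q_eq_0_iff: "q S y = 0 \<longleftrightarrow> y \<in> S"
proof
  assume "y \<in> S"
  then have "q S y \<le> 0"
    using Y.subspace_dist_le[OF N_seminorm subspace_S, of y y]
    by (simp add: Y.seminorm_0[OF N_seminorm])
  then show "q S y = 0"
    using Y.subspace_dist_nonneg[OF N_seminorm subspace_S, of y] by simp
next
  assume "q S y = 0"
  then show "y \<in> S"
    using Y.subspace_dist_pos[OF subspace_S, of y] by force
qed

lemma q_embed_seminorm: "X.is_seminorm (\<lambda>x. q S (t 1 x))"
  using q_seminorm unfolding X.is_seminorm_def Y.is_seminorm_def
  by (simp add: embed_add embed_scale valuation_iota)

lemma coset_map_eq_iff: "coset_map S y = coset_map S z \<longleftrightarrow> y - z \<in> S"
proof -
  have coset: "coset_map S y = {z. z - y \<in> S}" for y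
    unfolding coset_map_def by (force simp: image_iff)
  have "w - y \<in> S \<longleftrightarrow> w - z \<in> S" if "y - z \<in> S" for w
    using Y.subspace_add[OF subspace_S that, of "w - y"] Y.subspace_diff[OF subspace_S _ that, of "w - z"]
    by auto
  moreover have "y - y \<in> S"
    using subspace_S Y.subspace_0 by simp
  ultimately show ?thesis
    unfolding coset by blast
qed

text \<open>A preimage under \<open>coset_map S\<close> is a union of cosets, so with
  \<open>t 1 z - s\<close> it contains \<open>t 1 z\<close>; this turns balls of \<open>N\<close>
  into balls of \<open>q S\<close>. Conversely, an open set of X is the trace of an open union of
  cosets.\<close>

lemma G_eq_seminorm_topology: "G S = seminorm_topology (\<lambda>x. q S (t 1 x))"
  unfolding topology_eq
proof (intro allI iffI)
  fix W assume "openin (G S) W"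
  then obtain V where V: "openin (seminorm_topology N) (coset_map S -` V)"
      "W = t 1 -` (coset_map S -` V)"
    by (auto simp: G_hat_def openin_pullback_topology openin_quotient_pullback_topology
        Y.max_compatible_topology_eq)
  show "openin (seminorm_topology (\<lambda>x. q S (t 1 x))) W"
    unfolding openin_seminorm_topology
  proof
    fix x assume "x \<in> W"
    then have "t 1 x \<in> coset_map S -` V"
      using V(2) by simp
    then obtain e where e: "e > 0" "\<forall>z. N (z - t 1 x) < e \<longrightarrow> z \<in> coset_map S -` V"
      using V(1) unfolding openin_seminorm_topology by blast
    have "z \<in> W" if "q S (t 1 (z - x)) < e" for z
    proof -
      obtain s where s: "s \<in> S" "N (t 1 (z - x) - s) < e"
        using \<open>q S (t 1 (z - x)) < e\<close> q_less_iff by blast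
      then have "N ((t 1 z - s) - t 1 x) < e"
        by (simp add: embed_diff algebra_simps)
      then have "t 1 z - s \<in> coset_map S -` V"
        using e by blast
      moreover have "coset_map S (t 1 z) = coset_map S (t 1 z - s)"
        using s by (simp add: coset_map_eq_iff)
      ultimately show ?thesis
        using V(2) by simp
    qed
    then show "\<exists>e>0. \<forall>z. q S (t 1 (z - x)) < e \<longrightarrow> z \<in> W"
      using e by blast
  qed
next
  fix W assume W: "openin (seminorm_topology (\<lambda>x. q S (t 1 x))) W"
  \<comment> \<open>\<open>A\<close> is the union of the \<open>q S\<close>-balls around image
    points of \<open>W\<close> whose trace on X lies in \<open>W\<close>. It is open because
    \<open>q S\<close> is at most \<open>N\<close>, and a union of cosets because \<open>q S\<close>
    vanishes on \<open>S\<close>.\<close>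
  define A where "A = {y. \<exists>x\<in>W. \<exists>e>0. (\<forall>z. q S (t 1 (z - x)) < e \<longrightarrow> z \<in> W) \<and> q S (y - t 1 x) < e}"
  have A_nhd: "z \<in> A" if x: "x \<in> W" "\<forall>z. q S (t 1 (z - x)) < e \<longrightarrow> z \<in> W"
      "q S (y - t 1 x) < e" "q S (z - y) < e - q S (y - t 1 x)" for x y z e
  proof -
    have "q S (z - t 1 x) < e"
      using Y.seminorm_triangle[OF q_seminorm, of z "t 1 x" y] x(4) by simp
    moreover have "0 \<le> q S (y - t 1 x)"
      by (rule Y.seminorm_nonneg[OF q_seminorm])
    then have "e > 0"
      using x(3) by simp
    ultimately show ?thesis
      unfolding A_def using x(1,2) by blast
  qed
  have "openin (seminorm_topology N) A"
    unfolding openin_seminorm_topology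
  proof
    fix y assume "y \<in> A"
    then obtain x e where x: "x \<in> W" "\<forall>z. q S (t 1 (z - x)) < e \<longrightarrow> z \<in> W" "q S (y - t 1 x) < e"
      unfolding A_def by blast
    have "z \<in> A" if "N (z - y) < e - q S (y - t 1 x)" for z
      using A_nhd[OF x, of z] q_le_N[of "z - y"] that by simp
    with x(3) show "\<exists>e>0. \<forall>z. N (z - y) < e \<longrightarrow> z \<in> A"
      by (intro exI[of _ "e - q S (y - t 1 x)"]) simp
  qed
  moreover have "coset_map S -` (coset_map S ` A) = A"
  proof (intro equalityI subsetI)
    fix z assume "z \<in> coset_map S -` (coset_map S ` A)"
    then obtain y where y: "y \<in> A" "z - y \<in> S"
      by (auto simp: coset_map_eq_iff)
    then obtain x e where x: "x \<in> W" "\<forall>z. q S (t 1 (z - x)) < e \<longrightarrow> z \<in> W" "q S (y - t 1 x) < e"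
      unfolding A_def by blast
    moreover have "q S (z - y) = 0"
      using y(2) by (simp add: q_eq_0_iff)
    ultimately show "z \<in> A"
      using A_nhd[OF x] by simp
  qed auto
  moreover have "W = t 1 -` A \<inter> UNIV"
  proof (intro equalityI subsetI)
    fix x assume x: "x \<in> W"
    then obtain e where "e > 0" "\<forall>z. q S (t 1 (z - x)) < e \<longrightarrow> z \<in> W"
      using W unfolding openin_seminorm_topology by blast
    moreover from this have "q S (t 1 x - t 1 x) < e"
      by (simp add: Y.seminorm_0[OF q_seminorm])
    ultimately have "t 1 x \<in> A"
      unfolding A_def using x by blast
    then show "x \<in> t 1 -` A \<inter> UNIV"
      by simp
  next
    fix z assume "z \<in> t 1 -` A \<inter> UNIV"
    then show "z \<in> W"
      by (auto simp: A_def embed_diff)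
  qed
  ultimately show "openin (G S) W"
    unfolding G_hat_def openin_pullback_topology openin_quotient_pullback_topology
      Y.max_compatible_topology_eq
    by (intro exI[of _ A] conjI exI[of _ "coset_map S ` A"]) auto
qed

lemma G_compatible: "G S \<in> \<tau>"
  unfolding G_eq_seminorm_topology by (rule X.seminorm_topology_compatible[OF q_embed_seminorm])

text \<open>A point adherent to every \<open>q S\<close>-ball around 0 has distance 0 from
  \<open>S\<close>. Conversely, image points close to a point of \<open>S\<close> exist by density
  and have small \<open>q S\<close>.\<close>

lemma F_G: "F (G S) = S"
proof (intro equalityI subsetI)
  fix y assume y: "y \<in> F (G S)"
  have "q S y \<le> 0"
  proof (rule field_le_epsilon)
    fix e :: real assume "e > 0"
    have "openin (G S) {x. q S (t 1 (x - 0)) < e / 2}"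
      unfolding G_eq_seminorm_topology by (rule X.openin_seminorm_ball[OF q_embed_seminorm])
    moreover have "0 \<in> {x. q S (t 1 (x - 0)) < e / 2}"
      using \<open>e > 0\<close> by (simp add: embed_0 Y.seminorm_0[OF q_seminorm])
    ultimately obtain x where x: "q S (t 1 x) < e / 2" "N (t 1 x - y) < e / 2"
      using y \<open>e > 0\<close> unfolding in_F_iff by (metis (mono_tags, lifting) diff_zero half_gt_zero mem_Collect_eq)
    have "q S y \<le> q S (t 1 x) + q S (t 1 x - y)"
      using Y.seminorm_diff[OF q_seminorm, of "t 1 x" "t 1 x - y"] by simp
    then show "q S y \<le> 0 + e"
      using x q_le_N[of "t 1 x - y"] by simp
  qed
  then show "y \<in> S"
    using Y.seminorm_nonneg[OF q_seminorm, of y] q_eq_0_iff by simp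
next
  fix s assume s: "s \<in> S"
  show "s \<in> F (G S)"
    unfolding in_F_iff
  proof (intro allI impI)
    fix U and e :: real assume U: "openin (G S) U" "0 \<in> U" and e: "e > 0"
    obtain d where d: "d > 0" "\<forall>z. q S (t 1 (z - 0)) < d \<longrightarrow> z \<in> U"
      using U unfolding G_eq_seminorm_topology openin_seminorm_topology by blast
    obtain x where x: "N (t 1 x - s) < min d e"
      using embed_dense[of "min d e" s] d e by auto
    then have "q S (t 1 x) < d"
      using s q_less_iff by auto
    then show "\<exists>u\<in>U. N (t 1 u - s) < e"
      using x d by auto
  qed
qed

end

text \<open>Distances from the larger subspace are smaller, so its balls are larger.\<close>

lemma G_antimono:
  assumes "S \<in> \<sigma>" "S' \<in> \<sigma>" "S \<subseteq> S'"
  shows "topology_subset (G S') (G S)"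
  unfolding topology_subset_def G_eq_seminorm_topology[OF assms(1)] G_eq_seminorm_topology[OF assms(2)]
    openin_seminorm_topology
proof clarify
  have le: "q S' y \<le> q S y" for y
  proof (rule field_le_epsilon)
    fix e :: real assume "e > 0"
    then obtain s where "s \<in> S" "N (y - s) < q S y + e"
      using q_less_iff[OF assms(1), of y "q S y + e"] by auto
    then have "q S' y < q S y + e"
      using assms(3) q_less_iff[OF assms(2)] by blast
    then show "q S' y \<le> q S y + e"
      by simp
  qed
  fix U x assume "\<forall>x\<in>U. \<exists>e>0. \<forall>z. q S' (t 1 (z - x)) < e \<longrightarrow> z \<in> U" "x \<in> U"
  then obtain e where e: "e > 0" "\<forall>z. q S' (t 1 (z - x)) < e \<longrightarrow> z \<in> U"
    by blast
  have "z \<in> U" if "q S (t 1 (z - x)) < e" for z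
    using e(2) order_le_less_trans[OF le that] by simp
  with e(1) show "\<exists>e>0. \<forall>z. q S (t 1 (z - x)) < e \<longrightarrow> z \<in> U"
    by (intro exI[of _ e]) simp
qed

lemma subset_G_F:
  assumes T: "T \<in> \<tau>"
  shows "topology_subset T (G (F T))"
  unfolding topology_subset_def
proof clarify
  fix W assume W: "openin T W"
  note FT = F_subspace[OF T]
  show "openin (G (F T)) W"
    unfolding G_eq_seminorm_topology[OF FT] openin_seminorm_topology
  proof
    fix x assume "x \<in> W"
    define U where "U = {u. x + u \<in> W}"
    have U: "openin T U" "0 \<in> U"
      using X.openin_compatible_translate[OF T W] \<open>x \<in> W\<close> by (auto simp: U_def)
    obtain V where V: "openin T V" "0 \<in> V" "\<And>y z. y \<in> V \<Longrightarrow> z \<in> V \<Longrightarrow> y + z \<in> U"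
      using X.compatible_add_nhd[OF T U] by blast
    obtain d where d: "d > 0" "\<And>z. X.coord_norm z < d \<Longrightarrow> z \<in> V"
      using X.compatible_nhd_coord_norm[OF T V(1,2)] by blast
    \<comment> \<open>\<open>t 1 (z - x)\<close> is near some \<open>s\<close> in
      \<open>F T\<close>, and \<open>s\<close> is near \<open>t 1 v\<close> with \<open>v\<close> in
      \<open>V\<close>. The remainder \<open>z - x - v\<close> is small in norm, hence also in
      \<open>V\<close>, so \<open>z - x\<close> lies in \<open>U\<close>.\<close>
    have "z \<in> W" if z: "q (F T) (t 1 (z - x)) < d / 2" for z
    proof -
      obtain s where s: "s \<in> F T" "N (t 1 (z - x) - s) < d / 2"
        using z q_less_iff[OF FT] by blast
      then obtain v where v: "v \<in> V" "N (t 1 v - s) < d / 2"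
        using V(1,2) d(1) unfolding in_F_iff by (meson half_gt_zero)
      have "X.coord_norm (z - x - v) = N ((t 1 (z - x) - s) - (t 1 v - s))"
        by (simp add: embed_diff flip: coord_norm_embed)
      also have "\<dots> < d"
        using s v Y.seminorm_diff[OF N_seminorm, of "t 1 (z - x) - s" "t 1 v - s"] by simp
      finally have "v + (z - x - v) \<in> U"
        by (intro V(3) v d(2))
      then show ?thesis
        by (simp add: U_def)
    qed
    then show "\<exists>e>0. \<forall>z. q (F T) (t 1 (z - x)) < e \<longrightarrow> z \<in> W"
      using d(1) by (intro exI[of _ "d / 2"]) simp
  qed
qed

end

section \<open>The lattices\<close>

text \<open>Least upper and greatest lower bounds depend on the order alone, so \<open>f\<close>
  transports them in both directions. In particular \<open>L\<close> inherits the lattice property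
  from \<open>M\<close>.\<close>

lemma order_isomorphism_imp_lattice_isomorphism:
  assumes "partial_order L" "lattice M" and bij: "bij_betw f (carrier L) (carrier M)"
    and le: "\<And>x y. x \<in> carrier L \<Longrightarrow> y \<in> carrier L \<Longrightarrow> x \<sqsubseteq>\<^bsub>L\<^esub> y \<longleftrightarrow> f x \<sqsubseteq>\<^bsub>M\<^esub> f y"
  shows "lattice_isomorphism L M f"
proof -
  interpret L: partial_order L by fact
  interpret M: lattice M by fact
  have f: "f x \<in> carrier M" if "x \<in> carrier L" for x
    using bij that by (auto simp: bij_betw_def)
  have surj: "\<exists>x\<in>carrier L. f x = z" if "z \<in> carrier M" for z
  proof -
    have "z \<in> f ` carrier L"
      using bij that by (simp add: bij_betw_def)
    then show ?thesis
      by blast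
  qed
  have all_M: "(\<forall>z\<in>carrier L. P (f z)) \<longleftrightarrow> (\<forall>z\<in>carrier M. P z)" for P
    using f surj by metis
  have least: "least L s (Upper L {x, y}) \<longleftrightarrow> least M (f s) (Upper M {f x, f y})"
    and greatest: "greatest L s (Lower L {x, y}) \<longleftrightarrow> greatest M (f s) (Lower M {f x, f y})"
    if "x \<in> carrier L" "y \<in> carrier L" "s \<in> carrier L" for x y s
  proof -
    have "least L s (Upper L {x, y}) \<longleftrightarrow> (x \<sqsubseteq>\<^bsub>L\<^esub> s \<and> y \<sqsubseteq>\<^bsub>L\<^esub> s \<and>
        (\<forall>z\<in>carrier L. x \<sqsubseteq>\<^bsub>L\<^esub> z \<longrightarrow> y \<sqsubseteq>\<^bsub>L\<^esub> z \<longrightarrow> s \<sqsubseteq>\<^bsub>L\<^esub> z))"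
      using that by (auto simp: least_def Upper_def)
    also have "\<dots> \<longleftrightarrow> (f x \<sqsubseteq>\<^bsub>M\<^esub> f s \<and> f y \<sqsubseteq>\<^bsub>M\<^esub> f s \<and>
        (\<forall>z\<in>carrier L. f x \<sqsubseteq>\<^bsub>M\<^esub> f z \<longrightarrow> f y \<sqsubseteq>\<^bsub>M\<^esub> f z \<longrightarrow> f s \<sqsubseteq>\<^bsub>M\<^esub> f z))"
      using that by (simp add: le)
    also have "\<dots> \<longleftrightarrow> least M (f s) (Upper M {f x, f y})"
      unfolding all_M[of "\<lambda>z. f x \<sqsubseteq>\<^bsub>M\<^esub> z \<longrightarrow> f y \<sqsubseteq>\<^bsub>M\<^esub> z \<longrightarrow> f s \<sqsubseteq>\<^bsub>M\<^esub> z"]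
      using that by (auto simp: least_def Upper_def f)
    finally show "least L s (Upper L {x, y}) \<longleftrightarrow> least M (f s) (Upper M {f x, f y})" .
    have "greatest L s (Lower L {x, y}) \<longleftrightarrow> (s \<sqsubseteq>\<^bsub>L\<^esub> x \<and> s \<sqsubseteq>\<^bsub>L\<^esub> y \<and>
        (\<forall>z\<in>carrier L. z \<sqsubseteq>\<^bsub>L\<^esub> x \<longrightarrow> z \<sqsubseteq>\<^bsub>L\<^esub> y \<longrightarrow> z \<sqsubseteq>\<^bsub>L\<^esub> s))"
      using that by (auto simp: greatest_def Lower_def)
    also have "\<dots> \<longleftrightarrow> (f s \<sqsubseteq>\<^bsub>M\<^esub> f x \<and> f s \<sqsubseteq>\<^bsub>M\<^esub> f y \<and>
        (\<forall>z\<in>carrier L. f z \<sqsubseteq>\<^bsub>M\<^esub> f x \<longrightarrow> f z \<sqsubseteq>\<^bsub>M\<^esub> f y \<longrightarrow> f z \<sqsubseteq>\<^bsub>M\<^esub> f s))"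
      using that by (simp add: le)
    also have "\<dots> \<longleftrightarrow> greatest M (f s) (Lower M {f x, f y})"
      unfolding all_M[of "\<lambda>z. z \<sqsubseteq>\<^bsub>M\<^esub> f x \<longrightarrow> z \<sqsubseteq>\<^bsub>M\<^esub> f y \<longrightarrow> z \<sqsubseteq>\<^bsub>M\<^esub> f s"]
      using that by (auto simp: greatest_def Lower_def f)
    finally show "greatest L s (Lower L {x, y}) \<longleftrightarrow> greatest M (f s) (Lower M {f x, f y})" .
  qed
  have "lattice L"
  proof
    fix x y assume xy: "x \<in> carrier L" "y \<in> carrier L"
    obtain s where s: "least M s (Upper M {f x, f y})"
      using M.sup_of_two_exists f xy by blast
    then obtain s' where "s' \<in> carrier L" "f s' = s"
      using surj by (meson least_closed)
    then show "\<exists>s. least L s (Upper L {x, y})"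
      using s least xy by blast
    obtain i where i: "greatest M i (Lower M {f x, f y})"
      using M.inf_of_two_exists f xy by blast
    then obtain i' where "i' \<in> carrier L" "f i' = i"
      using surj by (meson greatest_closed)
    then show "\<exists>i. greatest L i (Lower L {x, y})"
      using i greatest xy by blast
  qed
  then interpret LL: lattice L .
  have "f (x \<squnion>\<^bsub>L\<^esub> y) = f x \<squnion>\<^bsub>M\<^esub> f y" "f (x \<sqinter>\<^bsub>L\<^esub> y) = f x \<sqinter>\<^bsub>M\<^esub> f y"
    if xy: "x \<in> carrier L" "y \<in> carrier L" for x y
  proof -
    \<comment> \<open>Join and meet are defined by choice; they are actual bounds only once
      existence in \<open>L\<close> is known.\<close>
    have "least L (x \<squnion>\<^bsub>L\<^esub> y) (Upper L {x, y})"
      unfolding join_def sup_def using LL.sup_of_two_exists[OF xy] by (rule someI_ex)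
    then have "least M (f (x \<squnion>\<^bsub>L\<^esub> y)) (Upper M {f x, f y})"
      using xy least by simp
    moreover have "least M (f x \<squnion>\<^bsub>M\<^esub> f y) (Upper M {f x, f y})"
      unfolding join_def sup_def using M.sup_of_two_exists[OF f[OF xy(1)] f[OF xy(2)]] by (rule someI_ex)
    ultimately show "f (x \<squnion>\<^bsub>L\<^esub> y) = f x \<squnion>\<^bsub>M\<^esub> f y"
      by (rule M.least_unique)
    have "greatest L (x \<sqinter>\<^bsub>L\<^esub> y) (Lower L {x, y})"
      unfolding meet_def inf_def using LL.inf_of_two_exists[OF xy] by (rule someI_ex)
    then have "greatest M (f (x \<sqinter>\<^bsub>L\<^esub> y)) (Lower M {f x, f y})"
      using xy greatest by simp
    moreover have "greatest M (f x \<sqinter>\<^bsub>M\<^esub> f y) (Lower M {f x, f y})"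
      unfolding meet_def inf_def using M.inf_of_two_exists[OF f[OF xy(1)] f[OF xy(2)]] by (rule someI_ex)
    ultimately show "f (x \<sqinter>\<^bsub>L\<^esub> y) = f x \<sqinter>\<^bsub>M\<^esub> f y"
      by (rule M.greatest_unique)
  qed
  then show ?thesis
    using bij \<open>lattice L\<close> \<open>lattice M\<close>
    by (simp add: lattice_isomorphism_def join_pres_def meet_pres_def)
qed

lemma partial_order_compatible_order: "partial_order (compatible_order kt s)"
  by unfold_locales
    (auto simp: compatible_order_def topology_subset_def topology_eq dest: topology_subset_antisym)

text \<open>Under reverse inclusion the join is the intersection and the meet is the span of the
  union.\<close>

lemma (in vector_space) lattice_subspace_order: "lattice (subspace_order scale)"
proof -
  interpret partial_order "subspace_order scale"
    by unfold_locales (auto simp: subspace_order_def)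
  show ?thesis
  proof
    fix S S' assume "S \<in> carrier (subspace_order scale)" "S' \<in> carrier (subspace_order scale)"
    then have S: "subspace S" "subspace S'"
      by (simp_all add: subspace_order_def subspaces_def)
    then have "least (subspace_order scale) (S \<inter> S') (Upper (subspace_order scale) {S, S'})"
      by (auto simp: least_def Upper_def subspace_order_def subspaces_def subspace_inter)
    then show "\<exists>s. least (subspace_order scale) s (Upper (subspace_order scale) {S, S'})" ..
    have "span (S \<union> S') \<subseteq> W" if "subspace W" "S \<subseteq> W" "S' \<subseteq> W" for W
      using that by (intro span_minimal) auto
    moreover have "S \<subseteq> span (S \<union> S')" "S' \<subseteq> span (S \<union> S')"
      using span_superset by blast+
    ultimately have "greatest (subspace_order scale) (span (S \<union> S')) (Lower (subspace_order scale) {S, S'})"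
      using S by (auto simp: greatest_def Lower_def subspace_order_def subspaces_def subspace_span)
    then show "\<exists>i. greatest (subspace_order scale) i (Lower (subspace_order scale) {S, S'})" ..
  qed
qed

section \<open>Locally compact completions\<close>

context completed_tensor_product
begin

text \<open>The powers of a small nonzero \<open>c\<close> have nonzero images of arbitrarily small
  value, so the origin is not isolated.\<close>

lemma nontrivial_hat: "nontrivial_valuation \<nu>'"
proof -
  obtain c where c: "0 < \<nu> c" "\<nu> c < 1"
    using nontrivial_valuation_small[OF nontrivial] .
  have "\<not> openin (val_topology \<nu>') {0}"
  proof
    assume "openin (val_topology \<nu>') {0}"
    then have "\<exists>d>0. \<forall>a. \<nu>' a < d \<longrightarrow> a = 0"
      unfolding val_topology_eq_seminorm_topology[OF valuation_hat] openin_seminorm_topology by simp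
    then obtain d where d: "d > 0" "\<And>a. \<nu>' a < d \<Longrightarrow> a = 0"
      by blast
    obtain m where "\<nu> c ^ m < d"
      using real_arch_pow_inv[OF d(1) c(2)] by blast
    then have "\<iota> (c ^ m) = 0"
      by (intro d(2)) (simp add: valuation_iota valuation_power valuation_base)
    then have "\<nu> (c ^ m) = 0"
      using valuation_iota[of "c ^ m"] by (simp add: valuation_0 valuation_hat)
    then show False
      using c by (simp add: valuation_power valuation_base)
  qed
  then show ?thesis
    using valuation_hat by (auto simp: nontrivial_valuation_def)
qed

text \<open>If every neighbourhood \<open>U\<close> of 0 contained points at distance at least \<open>e\<close> from \<open>F T\<close>, then
  scaling such points down and translating them by \<open>F T\<close> would give, for every \<open>U\<close>, a point in the
  closure of \<open>U\<close> that lies in a fixed compact set and at distance at least \<open>\<nu> c * e\<close> from \<open>F T\<close>.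
  By the finite intersection property some such point would belong to \<open>F T\<close>.\<close>

lemma locally_compact_small_nhd:
  assumes lc: "locally_compact_space (val_topology \<nu>')" and T: "T \<in> \<tau>" and "e > 0"
  shows "\<exists>U. openin T U \<and> 0 \<in> U \<and> (\<forall>u\<in>U. q (F T) (t 1 u) < e)"
proof (rule ccontr)
  assume contra: "\<not> ?thesis"
  have far: "\<exists>u\<in>U. e \<le> q (F T) (t 1 u)" if "openin T U" "0 \<in> U" for U
    using contra that by (meson linorder_not_le)
  note FT = F_subspace[OF T]
  obtain c where c: "0 < \<nu> c" "\<nu> c < 1"
    using nontrivial_valuation_small[OF nontrivial] .
  then have "c \<noteq> 0"
    using valuation_0[OF valuation_base] by auto
  \<comment> \<open>A far point is multiplied by powers of \<open>c\<close> until its distance first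
    drops below \<open>e\<close>. The last step changes the distance by the factor
    \<open>\<nu> c\<close>, so it stays at least \<open>\<nu> c * e\<close>.\<close>
  have annulus: "\<exists>x\<in>U. \<nu> c * e \<le> q (F T) (t 1 x) \<and> q (F T) (t 1 x) < e"
    if U: "openin T U" "0 \<in> U" for U
  proof -
    obtain d V where V: "d > 0" "openin T V" "0 \<in> V"
        "\<And>a y. \<nu> a < d \<Longrightarrow> y \<in> V \<Longrightarrow> sX a y \<in> U"
      using X.compatible_scale_nhd[OF T U, where x=0] by metis
    obtain m where m: "\<nu> c ^ m < d"
      using real_arch_pow_inv[OF V(1) c(2)] by blast
    \<comment> \<open>Asking for \<open>x\<close> in this scaled copy of \<open>V\<close> leaves
      enough room for all multiples of \<open>x\<close> by powers \<open>c ^ k\<close>,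
      \<open>k = 0\<close> included, to lie in \<open>U\<close>.\<close>
    have "openin T {x. sX (inverse (c ^ m)) x \<in> V}" "0 \<in> {x. sX (inverse (c ^ m)) x \<in> V}"
      using X.openin_compatible_scale[OF T V(2)] V(3) by auto
    from far[OF this] obtain x where x: "sX (inverse (c ^ m)) x \<in> V" "e \<le> q (F T) (t 1 x)"
      by blast
    have in_U: "sX (c ^ k) x \<in> U" for k
    proof -
      have "\<nu> (c ^ (k + m)) = \<nu> c ^ k * \<nu> c ^ m"
        by (simp add: valuation_mult valuation_power valuation_base power_add)
      also have "\<dots> \<le> 1 * \<nu> c ^ m"
        using c by (intro mult_right_mono power_le_one) auto
      finally have "sX (c ^ (k + m)) (sX (inverse (c ^ m)) x) \<in> U"
        using m by (intro V(4) x) simp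
      then show ?thesis
        using \<open>c \<noteq> 0\<close> by (simp add: power_add mult.assoc)
    qed
    let ?Q = "q (F T) (t 1 x)"
    have q_pow: "q (F T) (t 1 (sX (c ^ k) x)) = \<nu> c ^ k * ?Q" for k
      using X.seminorm_scale[OF q_embed_seminorm[OF FT]]
      by (simp add: valuation_power valuation_base)
    have "?Q > 0"
      using x \<open>e > 0\<close> by simp
    then obtain n where "\<nu> c ^ n < e / ?Q"
      using real_arch_pow_inv[of "e / ?Q" "\<nu> c"] c \<open>e > 0\<close> by auto
    then have ex: "\<nu> c ^ n * ?Q < e"
      using \<open>?Q > 0\<close> by (simp add: pos_less_divide_eq)
    define k where "k = (LEAST k. \<nu> c ^ k * ?Q < e)"
    have k: "\<nu> c ^ k * ?Q < e"
      unfolding k_def using ex by (rule LeastI)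
    then have "k \<noteq> 0"
      using x(2) by (intro notI) simp
    then obtain j where j: "k = Suc j"
      using not0_implies_Suc by blast
    then have "e \<le> \<nu> c ^ j * ?Q"
      using not_less_Least[of j "\<lambda>k. \<nu> c ^ k * ?Q < e"] by (simp add: k_def)
    then have "\<nu> c * e \<le> \<nu> c ^ k * ?Q"
      using c by (simp add: j mult.assoc)
    then show ?thesis
      using k q_pow in_U by metis
  qed
  \<comment> \<open>The bound \<open>N y \<le> e\<close> puts all these sets into one compact set,
    and \<open>A\<close> is monotone in \<open>U\<close>, which gives finite intersections.\<close>
  define A where "A U = {y. (\<forall>d>0. \<exists>u\<in>U. N (t 1 u - y) < d) \<and> N y \<le> e \<and> \<nu> c * e \<le> q (F T) y}" for U
  have A_nonempty: "A U \<noteq> {}" if U: "openin T U" "0 \<in> U" for U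
  proof -
    obtain V where V: "openin T V" "0 \<in> V" "\<And>x y. x \<in> V \<Longrightarrow> y \<in> V \<Longrightarrow> x + y \<in> U"
      using X.compatible_add_nhd[OF T U] by blast
    obtain x where x: "x \<in> V" "\<nu> c * e \<le> q (F T) (t 1 x)" "q (F T) (t 1 x) < e"
      using annulus[OF V(1,2)] by blast
    obtain s where s: "s \<in> F T" "N (t 1 x - s) < e"
      using x(3) q_less_iff[OF FT] by blast
    \<comment> \<open>Subtracting \<open>s\<close> brings the point into the norm ball without
      decreasing its distance from \<open>F T\<close>. The result is adherent to \<open>U\<close>
      since \<open>- s\<close> is adherent to \<open>V\<close>.\<close>
    have "q (F T) s = 0"
      using s q_eq_0_iff[OF FT] by simp
    then have "q (F T) (t 1 x) \<le> q (F T) (t 1 x - s)"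
      using Y.seminorm_add[OF q_seminorm[OF FT], of "t 1 x - s" s] by simp
    moreover have "\<exists>u\<in>U. N (t 1 u - (t 1 x - s)) < d" if "d > 0" for d
    proof -
      have "- s \<in> F T"
        using Y.subspace_neg[OF subspace_S[OF FT] s(1)] .
      then obtain v where v: "v \<in> V" "N (t 1 v - - s) < d"
        using V(1,2) \<open>d > 0\<close> unfolding in_F_iff by blast
      have "t 1 (x + v) - (t 1 x - s) = t 1 v - - s"
        by (simp add: embed_add)
      then show ?thesis
        using v V(3)[OF x(1)] by metis
    qed
    ultimately have "t 1 x - s \<in> A U"
      using s x by (simp add: A_def)
    then show ?thesis
      by blast
  qed
  obtain K where K: "compactin (seminorm_topology N) K" "{y. N y \<le> e} \<subseteq> K"
    using Y.compactin_coord_ball[OF nontrivial_hat lc] by blast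
  define \<U> where "\<U> = {U. openin T U \<and> 0 \<in> U}"
  let ?cl = "\<lambda>U. seminorm_topology N closure_of A U"
  have "K \<inter> \<Inter>(?cl ` \<U>) \<noteq> {}"
  proof -
    have "K \<inter> \<Inter>\<F> \<noteq> {}" if fin: "finite \<F>" "\<F> \<subseteq> ?cl ` \<U>" for \<F>
    proof -
      obtain \<V> where \<V>: "\<V> \<subseteq> \<U>" "finite \<V>" "\<F> = ?cl ` \<V>"
        using finite_subset_image[OF fin] by blast
      \<comment> \<open>Inserting \<open>UNIV\<close> makes the family nonempty, so that the empty
        subfamily needs no separate case.\<close>
      have "openin T (\<Inter>(insert UNIV \<V>))"
        using \<V>(1,2) openin_topspace[of T] X.compatible_topspace[OF T]
        by (intro openin_Inter) (auto simp: \<U>_def)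
      moreover have "0 \<in> \<Inter>(insert UNIV \<V>)"
        using \<V>(1) by (auto simp: \<U>_def)
      ultimately obtain y where y: "y \<in> A (\<Inter>(insert UNIV \<V>))"
        using A_nonempty by blast
      have "y \<in> ?cl V" if "V \<in> \<V>" for V
      proof -
        have "y \<in> A V"
          using y that unfolding A_def by blast
        then show ?thesis
          using closure_of_subset[of "A V" "seminorm_topology N"] by auto
      qed
      moreover have "y \<in> K"
        using y K(2) by (auto simp: A_def)
      ultimately show ?thesis
        using \<V>(3) by blast
    qed
    then show ?thesis
      using spec[OF conjunct2[OF iffD1[OF compactin_fip K(1)]], of "?cl ` \<U>"] by simp
  qed
  then obtain y where y: "y \<in> ?cl U" if "U \<in> \<U>" for U
    by blast
  have y_near: "\<exists>a\<in>A U. N (a - y) < d" if "openin T U" "0 \<in> U" "d > 0" for U d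
    using y that unfolding \<U>_def Y.in_closure_of_seminorm_topology[OF N_seminorm] by blast
  have "y \<in> F T"
    unfolding in_F_iff
  proof (intro allI impI)
    fix U and d :: real assume U: "openin T U" "0 \<in> U" and "d > 0"
    then obtain a where a: "a \<in> A U" "N (a - y) < d / 2"
      using y_near[of U "d / 2"] by auto
    then obtain u where u: "u \<in> U" "N (t 1 u - a) < d / 2"
      using \<open>d > 0\<close> unfolding A_def by (auto dest: spec[of _ "d / 2"])
    then have "N (t 1 u - y) < d"
      using Y.seminorm_triangle[OF N_seminorm, of "t 1 u" y a] a by simp
    then show "\<exists>u\<in>U. N (t 1 u - y) < d"
      using u by blast
  qed
  then have "q (F T) y = 0"
    using q_eq_0_iff[OF FT] by simp
  \<comment> \<open>\<open>y\<close> lies only in the closure of \<open>A UNIV\<close>, so the lower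
    bound on the distance is tested at a point \<open>a\<close> of \<open>A UNIV\<close> closer to
    \<open>y\<close> than \<open>\<nu> c * e\<close>.\<close>
  moreover have "openin T UNIV"
    using openin_topspace[of T] X.compatible_topspace[OF T] by simp
  then obtain a where a: "a \<in> A UNIV" "N (a - y) < \<nu> c * e"
    using y_near[of UNIV "\<nu> c * e"] c \<open>e > 0\<close> by auto
  moreover have "q (F T) a \<le> q (F T) (a - y) + q (F T) y"
    using Y.seminorm_add[OF q_seminorm[OF FT], of "a - y" y] by simp
  ultimately show False
    using q_le_N[OF FT, of "a - y"] by (simp add: A_def)
qed

text \<open>Beyond \<open>subset_G_F\<close>, each ball of the \<open>q (F T)\<close> seminorm
  around 0 contains a neighbourhood of 0 for \<open>T\<close> by
  \<open>locally_compact_small_nhd\<close>; translation gives the remaining inclusion.\<close>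

lemma G_F:
  assumes "locally_compact_space (val_topology \<nu>')" and T: "T \<in> \<tau>"
  shows "G (F T) = T"
proof (rule topology_subset_antisym)
  show "topology_subset (G (F T)) T"
    unfolding topology_subset_def
  proof clarify
    fix W assume W: "openin (G (F T)) W"
    show "openin T W"
    proof (rule X.openin_compatibleI[OF T])
      fix x assume "x \<in> W"
      then obtain e where e: "e > 0" "\<forall>z. q (F T) (t 1 (z - x)) < e \<longrightarrow> z \<in> W"
        using W unfolding G_eq_seminorm_topology[OF F_subspace[OF T]] openin_seminorm_topology
        by blast
      obtain U where "openin T U" "0 \<in> U" "\<forall>u\<in>U. q (F T) (t 1 u) < e"
        using locally_compact_small_nhd[OF assms e(1)] by blast
      then show "\<exists>U. openin T U \<and> 0 \<in> U \<and> (\<forall>u\<in>U. x + u \<in> W)"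
        using e(2) by (intro exI[of _ U]) simp
    qed
  qed
qed (rule subset_G_F[OF T])

lemma F_lattice_isomorphism:
  assumes "locally_compact_space (val_topology \<nu>')"
  shows "lattice_isomorphism (compatible_order (val_topology \<nu>) sX) (subspace_order sY) F"
proof (rule order_isomorphism_imp_lattice_isomorphism[OF partial_order_compatible_order
      Y.lattice_subspace_order])
  show "bij_betw F (carrier (compatible_order (val_topology \<nu>) sX)) (carrier (subspace_order sY))"
    using F_subspace G_compatible G_F[OF assms] F_G
    by (intro bij_betw_byWitness[where f' = G]) (auto simp: compatible_order_def subspace_order_def)
  fix T T'
  assume "T \<in> carrier (compatible_order (val_topology \<nu>) sX)"
    "T' \<in> carrier (compatible_order (val_topology \<nu>) sX)"
  then have T: "T \<in> \<tau>" "T' \<in> \<tau>"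
    by (simp_all add: compatible_order_def)
  \<comment> \<open>\<open>F\<close> also reflects the order, because \<open>G\<close> reverses
    inclusions and is a left inverse of \<open>F\<close>.\<close>
  have "topology_subset T T'" if "F T' \<subseteq> F T"
    using G_antimono[OF F_subspace F_subspace that] T by (simp add: G_F assms)
  then show "T \<sqsubseteq>\<^bsub>compatible_order (val_topology \<nu>) sX\<^esub> T' \<longleftrightarrow> F T \<sqsubseteq>\<^bsub>subspace_order sY\<^esub> F T'"
    using F_antimono by (auto simp: compatible_order_def subspace_order_def)
qed

end

theorem theorem3p3:
  fixes \<nu> :: "'k::field \<Rightarrow> real"
    and \<nu>' :: "'l::field \<Rightarrow> real"
    and \<iota> :: "'k \<Rightarrow> 'l"
    and sX :: "'k \<Rightarrow> 'x::ab_group_add \<Rightarrow> 'x"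
    and sY :: "'l \<Rightarrow> 'y::ab_group_add \<Rightarrow> 'y"
    and t :: "'l \<Rightarrow> 'x \<Rightarrow> 'y"
  defines "\<tau> \<equiv> compatible_topologies (val_topology \<nu>) sX"
    and "\<sigma> \<equiv> subspaces sY"
    and "F \<equiv> F_hat \<nu>' sY t"
    and "G \<equiv> G_hat \<nu>' sY t"
  assumes "nontrivial_valuation \<nu>"
    and "valuation_completion \<nu> \<nu>' \<iota>"
    and "\<exists>B. finite_dimensional_vector_space sX B"
    and "is_tensor_product \<iota> sX sY t"
  shows
    "(F \<in> \<tau> \<rightarrow> \<sigma> \<and> G \<in> \<sigma> \<rightarrow> \<tau> \<and>
      (\<forall>T\<in>\<tau>. \<forall>T'\<in>\<tau>. topology_subset T T' \<longrightarrow> F T' \<subseteq> F T) \<and>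
      (\<forall>S\<in>\<sigma>. \<forall>S'\<in>\<sigma>. S \<subseteq> S' \<longrightarrow> topology_subset (G S') (G S))) \<and>
     (\<forall>S\<in>\<sigma>. F (G S) = S) \<and>
     (\<forall>T\<in>\<tau>. topology_subset T (G (F T))) \<and>
     (locally_compact_space (val_topology \<nu>') \<longrightarrow>
       (\<forall>T\<in>\<tau>. G (F T) = T) \<and>
       lattice_isomorphism (compatible_order (val_topology \<nu>) sX) (subspace_order sY) F)"
proof -
  \<comment> \<open>\<open>F_hat\<close> and \<open>G_hat\<close> are defined without coordinates,
    so any basis may be fixed.\<close>
  obtain B where "finite_dimensional_vector_space sX B"
    using assms(7) by blast
  then interpret completed_tensor_product sX B \<nu> \<nu>' \<iota> sY t
    using assms(5,6,8)
    by (intro completed_tensor_product.intro completed_tensor_product_axioms.intro)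
  show ?thesis
    unfolding assms(1-4)
    by (intro conjI impI ballI funcsetI F_subspace G_compatible F_antimono G_antimono F_G subset_G_F
        G_F F_lattice_isomorphism)
qed

end
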